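(* Let $K$ be an algebraically closed field of characteristic $0$ and let $A$ be a $\mathbb{Z}_2$-graded regular $K$-algebra with minimal regular decomposition. If $C$ is a finite dimensional $\mathbb{Z}_2$-graded algebra such that $T_{\mathbb{Z}_2}(A)=T_{\mathbb{Z}_2}(E(C))$, then there exist $r\ge0$ and $p\ge1$ such that $$C\cong \underbrace{K\oplus\cdots\oplus K}_{r}\oplus\underbrace{(K\oplus c_{r+1}K)\oplus\cdots\oplus(K\oplus c_{r+p}K)}_{p}\oplus J(C),$$ where, if $W_i\cong K\oplus c_iK$, then $c_i^2=1_{W_i}$, the unit of $W_i$, for all $r+1\le i\le r+p$.
   Context: All algebras are associative unital algebras over $K$. $J(C)$ is the Jacobson radical of $C$. The displayed decomposition is a graded Wedderburn–Malcev decomposition: $C=W_1\oplus\cdots\oplus W_{r+p}\oplus J(C)$ as a direct sum of graded vector spaces, where $W_1\oplus\cdots\oplus W_{r+p}$ is a graded subalgebra that is a direct sum (as algebras) of graded simple algebras, $W_i\cong K$ with trivial grading for $i\le r$, and $W_i\cong K\oplus c_iK$ with $K$ in degree $0$ and $c_iK$ in degree $1$ for $r+1\le i\le r+p$. A $\mathbb{Z}_2$-graded algebra $A=A_0\oplus A_1$ is regular if (i) for every $n\in\mathbb{N}$ and every $(g_1,\dots,g_n)\in\mathbb{Z}_2^n$ there exist $a_i\in A_{g_i}$ with $a_1\cdots a_n\neq0$; and (ii) for every $g,h\in\mathbb{Z}_2$ there is $\beta(g,h)\in K^*$ (depending only on $g,h$) with $a_ga_h=\beta(g,h)a_ha_g$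 for all $a_g\in A_g$, $a_h\in A_h$. Its regular decomposition is minimal if there are no $h\ne k$ in $\mathbb{Z}_2$ with $\beta(g,h)=\beta(g,k)$ for all $g\in\mathbb{Z}_2$. $T_{\mathbb{Z}_2}(R)$ is the ideal of $\mathbb{Z}_2$-graded polynomial identities of $R$: the set of polynomials in the free $\mathbb{Z}_2$-graded algebra (infinitely many noncommuting variables of each degree) that vanish when the variables are replaced by arbitrary homogeneous elements of $R$ of the corresponding degrees. $E$ is the unital algebra generated by $e_1,e_2,\dots$ with relations $e_ie_j=-e_je_i$ for all $i,j$; $E_0$ (resp. $E_1$) is the span of monomials of even length, including $1$ (resp. odd length). The Grassmann envelope of $C=C_0\oplus C_1$ is $E(C)=(C_0\otimes E_0)\oplus(C_1\otimes E_1)$, with degree $0$ and degree $1$ components these two summands. *)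

theory Defs
  imports
    "HOL-Computational_Algebra.Computational_Algebra"
    "HOL-Library.Z2"
    "HOL-Library.Poly_Mapping"
begin

section \<open>Graded algebras\<close>

locale assoc_algebra = vector_space scale
  for scale :: "'k::field \<Rightarrow> 'a::ring_1 \<Rightarrow> 'a" +
  assumes scale_mult_left: "scale k x * y = scale k (x * y)"
    and scale_mult_right: "x * scale k y = scale k (x * y)"

definition fin_dim :: "('k::field \<Rightarrow> 'a::ab_group_add \<Rightarrow> 'a) \<Rightarrow> bool" where
  "fin_dim scale \<longleftrightarrow> (\<exists>B. finite B \<and> module.span scale B = UNIV)"

definition internal_direct_sum :: "'i set \<Rightarrow> ('i \<Rightarrow> 'a::ab_group_add set) \<Rightarrow> 'a set \<Rightarrow> bool" where
  "internal_direct_sum I V U \<longleftrightarrow>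
     (\<forall>i\<in>I. V i \<subseteq> U) \<and>
     (\<forall>x\<in>U. \<exists>!v. v \<in> extensional I \<and> (\<forall>i\<in>I. v i \<in> V i) \<and> x = (\<Sum>i\<in>I. v i))"

locale Z2_graded_algebra = assoc_algebra scale
  for scale :: "'k::field \<Rightarrow> 'a::ring_1 \<Rightarrow> 'a" +
  fixes G :: "bit \<Rightarrow> 'a set"
  assumes component_subspace: "subspace (G g)"
    and components_direct: "internal_direct_sum UNIV G UNIV"
    and component_mult: "x \<in> G g \<Longrightarrow> y \<in> G h \<Longrightarrow> x * y \<in> G (g + h)"

definition regular_grading ::
    "('k::field \<Rightarrow> 'a::ring_1 \<Rightarrow> 'a) \<Rightarrow> (bit \<Rightarrow> 'a set) \<Rightarrow> (bit \<Rightarrow> bit \<Rightarrow> 'k) \<Rightarrow> bool" where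
  "regular_grading scale G \<beta> \<longleftrightarrow>
     (\<forall>gs. \<exists>as. list_all2 (\<lambda>a g. a \<in> G g) as gs \<and> prod_list as \<noteq> 0) \<and>
     (\<forall>g h. \<beta> g h \<noteq> 0 \<and> (\<forall>a\<in>G g. \<forall>b\<in>G h. a * b = scale (\<beta> g h) (b * a)))"

definition minimal_decomposition :: "(bit \<Rightarrow> bit \<Rightarrow> 'k) \<Rightarrow> bool" where
  "minimal_decomposition \<beta> \<longleftrightarrow> \<not> (\<exists>h k. h \<noteq> k \<and> (\<forall>g. \<beta> g h = \<beta> g k))"


section \<open>Graded polynomial identities\<close>

text \<open>
  The variable \<open>(g, i)\<close> is the \<open>i\<close>-th variable of degree \<open>g\<close>. An element of the free unital
  algebra is a finitely supported family of coefficients indexed by words in the variables.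
\<close>

type_synonym 'k graded_poly = "(bit \<times> nat) list \<Rightarrow>\<^sub>0 'k"

definition eval_poly ::
    "('k::field \<Rightarrow> 'a::ring_1 \<Rightarrow> 'a) \<Rightarrow> (bit \<times> nat \<Rightarrow> 'a) \<Rightarrow> 'k graded_poly \<Rightarrow> 'a" where
  "eval_poly scale \<phi> f = (\<Sum>w\<in>Poly_Mapping.keys f. scale (Poly_Mapping.lookup f w) (prod_list (map \<phi> w)))"

text \<open>
  The algebra with components \<open>G 0\<close> and \<open>G 1\<close> may be a proper subalgebra of the type
  \<open>'a\<close>; only its homogeneous elements enter.
\<close>

definition T_Z2 ::
    "('k::field \<Rightarrow> 'a::ring_1 \<Rightarrow> 'a) \<Rightarrow> (bit \<Rightarrow> 'a set) \<Rightarrow> 'k graded_poly set" where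
  "T_Z2 scale G = {f. \<forall>\<phi>. (\<forall>g i. \<phi> (g, i) \<in> G g) \<longrightarrow> eval_poly scale \<phi> f = 0}"


section \<open>The Grassmann algebra\<close>

text \<open>
  \<open>'a grassmann\<close> is the Grassmann algebra on \<open>e\<^sub>0, e\<^sub>1, \<dots>\<close> with coefficients in the ring
  \<open>'a\<close>, the coefficients commuting with the \<open>e\<^sub>i\<close>. An element is the finite sum
  \<open>\<Sum>S. x\<^sub>S e\<^sub>S\<close>, where \<open>e\<^sub>S\<close> is the product of the \<open>e\<^sub>i\<close>, \<open>i \<in> S\<close>, in increasing order.
  For a field \<open>'k\<close> of characteristic other than 2, \<open>'k grassmann\<close> is the algebra \<open>E\<close>; for an
  algebra \<open>'c\<close> over \<open>'k\<close>, \<open>'c grassmann\<close> is \<open>'c \<otimes> E\<close>, since the \<open>e\<^sub>S\<close> form a basis of \<open>E\<close>.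
\<close>

typedef (overloaded) 'a grassmann =
  "{x :: nat set \<Rightarrow> 'a::zero. finite {S. x S \<noteq> 0} \<and> (\<forall>S. x S \<noteq> 0 \<longrightarrow> finite S)}"
  morphisms gcoeff Abs_grassmann
  by (rule exI[of _ "\<lambda>_. 0"]) simp

setup_lifting type_definition_grassmann

text \<open>For disjoint \<open>S\<close> and \<open>T\<close>: \<open>e\<^sub>S e\<^sub>T = (-1)^(inversions S T) e\<^bsub>S \<union> T\<^esub>\<close>.\<close>

definition inversions :: "nat set \<Rightarrow> nat set \<Rightarrow> nat" where
  "inversions S T = card {(s, t). s \<in> S \<and> t \<in> T \<and> t < s}"

definition shuffle_sign :: "nat set \<Rightarrow> nat set \<Rightarrow> 'a::ring_1" where
  "shuffle_sign S T = (- 1) ^ inversions S T"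

lemma shuffle_sign_cases: "shuffle_sign S T = (1 :: 'a::ring_1) \<or> shuffle_sign S T = (- 1 :: 'a)"
  by (auto simp: shuffle_sign_def minus_one_power_iff)

lemma shuffle_sign_commute: "shuffle_sign S T * (a :: 'a::ring_1) = a * shuffle_sign S T"
  using shuffle_sign_cases[of S T, where 'a='a] by auto

lemma shuffle_sign_commute_left:
  "a * (shuffle_sign S T * b) = shuffle_sign S T * (a * b :: 'a::ring_1)"
  using shuffle_sign_cases[of S T, where 'a='a] by auto

lemma finite_inversions: "finite S \<Longrightarrow> finite T \<Longrightarrow> finite {(s, t). s \<in> S \<and> t \<in> T \<and> t < (s::nat)}"
  by (rule finite_subset[of _ "S \<times> T"]) auto

lemma shuffle_sign_Un_left:
  assumes "finite S" "finite T" "finite U" "S \<inter> T = {}"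
  shows "shuffle_sign (S \<union> T) U = shuffle_sign S U * shuffle_sign T U"
proof -
  have "{(s, t). s \<in> S \<union> T \<and> t \<in> U \<and> t < s} =
      {(s, t). s \<in> S \<and> t \<in> U \<and> t < s} \<union> {(s, t). s \<in> T \<and> t \<in> U \<and> t < s}"
    by auto
  then have "inversions (S \<union> T) U = inversions S U + inversions T U"
    unfolding inversions_def using assms finite_inversions
    by (simp add: card_Un_disjoint disjoint_iff)
  then show ?thesis by (simp add: shuffle_sign_def power_add)
qed

lemma shuffle_sign_Un_right:
  assumes "finite S" "finite T" "finite U" "T \<inter> U = {}"
  shows "shuffle_sign S (T \<union> U) = shuffle_sign S T * shuffle_sign S U"
proof -
  have "{(s, t). s \<in> S \<and> t \<in> T \<union> U \<and> t < s} =
      {(s, t). s \<in> S \<and> t \<in> T \<and> t < s} \<union> {(s, t). s \<in> S \<and> t \<in> U \<and> t < s}"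
    by auto
  then have "inversions S (T \<union> U) = inversions S T + inversions S U"
    unfolding inversions_def using assms finite_inversions
    by (simp add: card_Un_disjoint disjoint_iff)
  then show ?thesis by (simp add: shuffle_sign_def power_add)
qed

lemma shuffle_sign_empty [simp]: "shuffle_sign {} S = 1" "shuffle_sign S {} = 1"
  by (simp_all add: shuffle_sign_def inversions_def)

instantiation grassmann :: (ring_1) ring_1
begin

lift_definition zero_grassmann :: "'a grassmann" is "\<lambda>_. 0" by simp

lift_definition one_grassmann :: "'a grassmann" is "\<lambda>S. if S = {} then 1 else 0" by simp

lift_definition plus_grassmann :: "'a grassmann \<Rightarrow> 'a grassmann \<Rightarrow> 'a grassmann"
  is "\<lambda>x y S. x S + y S"
proof -
  fix x y :: "nat set \<Rightarrow> 'a"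
  assume x: "finite {S. x S \<noteq> 0} \<and> (\<forall>S. x S \<noteq> 0 \<longrightarrow> finite S)"
    and y: "finite {S. y S \<noteq> 0} \<and> (\<forall>S. y S \<noteq> 0 \<longrightarrow> finite S)"
  have "finite {S. x S + y S \<noteq> 0}"
    by (rule finite_subset[of _ "{S. x S \<noteq> 0} \<union> {S. y S \<noteq> 0}"]) (use x y in auto)
  then show "finite {S. x S + y S \<noteq> 0} \<and> (\<forall>S. x S + y S \<noteq> 0 \<longrightarrow> finite S)"
    using x y by force
qed

lift_definition uminus_grassmann :: "'a grassmann \<Rightarrow> 'a grassmann" is "\<lambda>x S. - x S" by simp

definition minus_grassmann :: "'a grassmann \<Rightarrow> 'a grassmann \<Rightarrow> 'a grassmann" where
  "minus_grassmann x y = x + - y"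

text \<open>If \<open>U\<close> is infinite, then so is \<open>Pow U\<close> and the sum is \<open>0\<close>.\<close>

lift_definition times_grassmann :: "'a grassmann \<Rightarrow> 'a grassmann \<Rightarrow> 'a grassmann"
  is "\<lambda>x y U. \<Sum>S\<in>Pow U. shuffle_sign S (U - S) * (x S * y (U - S))"
proof -
  fix x y :: "nat set \<Rightarrow> 'a"
  assume x: "finite {S. x S \<noteq> 0} \<and> (\<forall>S. x S \<noteq> 0 \<longrightarrow> finite S)"
    and y: "finite {S. y S \<noteq> 0} \<and> (\<forall>S. y S \<noteq> 0 \<longrightarrow> finite S)"
  let ?p = "\<lambda>U. \<Sum>S\<in>Pow U. shuffle_sign S (U - S) * (x S * y (U - S))"
  have "\<exists>S T. U = S \<union> T \<and> x S \<noteq> 0 \<and> y T \<noteq> 0" if nz: "?p U \<noteq> 0" for U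
  proof -
    obtain S where S: "S \<in> Pow U" "shuffle_sign S (U - S) * (x S * y (U - S)) \<noteq> 0"
      using sum.not_neutral_contains_not_neutral[OF nz] by blast
    from S(2) have "x S \<noteq> 0" by (intro notI) simp
    moreover from S(2) have "y (U - S) \<noteq> 0" by (intro notI) simp
    moreover from S(1) have "U = S \<union> (U - S)" by blast
    ultimately show ?thesis by (intro exI conjI)
  qed
  then have "{U. ?p U \<noteq> 0} \<subseteq> (\<lambda>(S, T). S \<union> T) ` ({S. x S \<noteq> 0} \<times> {T. y T \<noteq> 0})"
    unfolding image_def by blast
  then have "finite {U. ?p U \<noteq> 0}"
    by (rule finite_subset) (use x y in simp)
  moreover have "finite U" if "?p U \<noteq> 0" for U
    using that by (metis (no_types, lifting) finite_Pow_iff sum.infinite)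
  ultimately show "finite {U. ?p U \<noteq> 0} \<and> (\<forall>U. ?p U \<noteq> 0 \<longrightarrow> finite U)"
    by blast
qed

instance
proof
  fix a b c :: "'a grassmann"
  show "a + b + c = a + (b + c)" by transfer (simp add: add.assoc)
  show "a + b = b + a" by transfer (simp add: add.commute)
  show "0 + a = a" by transfer simp
  show "- a + a = 0" by transfer simp
  show "a - b = a + - b" by (rule minus_grassmann_def)
  show "(0::'a grassmann) \<noteq> 1" by transfer (auto simp: fun_eq_iff)
  show "(a + b) * c = a * c + b * c"
    by transfer (simp add: distrib_left distrib_right sum.distrib)
  show "a * (b + c) = a * b + a * c"
    by transfer (simp add: distrib_left distrib_right sum.distrib)
  show "1 * a = a"
  proof transfer
    fix a :: "nat set \<Rightarrow> 'a"
    assume a: "finite {S. a S \<noteq> 0} \<and> (\<forall>S. a S \<noteq> 0 \<longrightarrow> finite S)"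
    show "(\<lambda>U. \<Sum>S\<in>Pow U. shuffle_sign S (U - S) * ((if S = {} then 1 else 0) * a (U - S))) = a"
    proof
      fix U
      have "(\<Sum>S\<in>Pow U. shuffle_sign S (U - S) * ((if S = {} then 1 else 0) * a (U - S))) =
          (\<Sum>S\<in>Pow U. if S = {} then a U else 0)"
        by (rule sum.cong) auto
      also have "\<dots> = a U" using a by (cases "finite U") auto
      finally show "(\<Sum>S\<in>Pow U. shuffle_sign S (U - S) * ((if S = {} then 1 else 0) * a (U - S))) = a U" .
    qed
  qed
  show "a * 1 = a"
  proof transfer
    fix a :: "nat set \<Rightarrow> 'a"
    assume a: "finite {S. a S \<noteq> 0} \<and> (\<forall>S. a S \<noteq> 0 \<longrightarrow> finite S)"
    show "(\<lambda>U. \<Sum>S\<in>Pow U. shuffle_sign S (U - S) * (a S * (if U - S = {} then 1 else 0))) = a"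
    proof
      fix U
      have "(\<Sum>S\<in>Pow U. shuffle_sign S (U - S) * (a S * (if U - S = {} then 1 else 0))) =
          (\<Sum>S\<in>Pow U. if S = U then a U else 0)"
        by (rule sum.cong) auto
      also have "\<dots> = a U" using a by (cases "finite U") auto
      finally show "(\<Sum>S\<in>Pow U. shuffle_sign S (U - S) * (a S * (if U - S = {} then 1 else 0))) = a U" .
    qed
  qed
  show "a * b * c = a * (b * c)"
  proof transfer
    fix x y z :: "nat set \<Rightarrow> 'a"
    have "(\<Sum>S\<in>Pow U. shuffle_sign S (U - S) *
              ((\<Sum>T\<in>Pow S. shuffle_sign T (S - T) * (x T * y (S - T))) * z (U - S))) =
          (\<Sum>T\<in>Pow U. shuffle_sign T (U - T) *
              (x T * (\<Sum>R\<in>Pow (U - T). shuffle_sign R (U - T - R) * (y R * z (U - T - R)))))"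
      (is "?l = ?r") for U
    proof (cases "finite U")
      case True
      let ?f = "\<lambda>S T. shuffle_sign S (U - S) * (shuffle_sign T (S - T) * (x T * y (S - T) * z (U - S)))"
      let ?g = "\<lambda>T R. shuffle_sign T (U - T) * (shuffle_sign R (U - T - R) * (x T * y R * z (U - T - R)))"
      have comm: "x T * (shuffle_sign R V * b) = shuffle_sign R V * (x T * b)" for T R V b
        by (rule shuffle_sign_commute_left)
      have "?l = (\<Sum>S\<in>Pow U. \<Sum>T\<in>Pow S. ?f S T)"
        by (simp add: sum_distrib_left sum_distrib_right mult.assoc)
      also have "\<dots> = (\<Sum>(S, T)\<in>Sigma (Pow U) Pow. ?f S T)"
        using True by (intro sum.Sigma) (auto intro: finite_subset)
      also have "\<dots> = (\<Sum>(T, R)\<in>Sigma (Pow U) (\<lambda>T. Pow (U - T)). ?g T R)"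
      proof (rule sum.reindex_bij_witness[of _ "\<lambda>(T, R). (T \<union> R, T)" "\<lambda>(S, T). (T, S - T)"])
        fix p assume "p \<in> Sigma (Pow U) Pow"
        then obtain S T where p: "p = (S, T)" and ST: "T \<subseteq> S" "S \<subseteq> U" by auto
        have fin: "finite T" "finite (S - T)" "finite (U - S)" "finite S"
          using ST True by (meson finite_Diff finite_subset)+
        have eqs: "U - T = (S - T) \<union> (U - S)" "U - T - (S - T) = U - S" "T \<union> (S - T) = S"
          using ST by blast+
        have "shuffle_sign S (U - S) * shuffle_sign T (S - T) =
            (shuffle_sign T (U - S) * shuffle_sign (S - T) (U - S) * shuffle_sign T (S - T) :: 'a)"
          using shuffle_sign_Un_left[OF fin(1-3), where 'a='a] unfolding eqs(3) by simp
        moreover have "shuffle_sign T (U - T) =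
            (shuffle_sign T (S - T) * shuffle_sign T (U - S) :: 'a)"
          unfolding eqs(1) by (rule shuffle_sign_Un_right) (use fin ST in auto)
        ultimately have "shuffle_sign S (U - S) * shuffle_sign T (S - T) =
            (shuffle_sign T (U - T) * shuffle_sign (S - T) (U - S) :: 'a)"
          using shuffle_sign_commute[of T "S - T" "shuffle_sign T (U - S) * shuffle_sign (S - T) (U - S) :: 'a"]
          by (simp add: mult.assoc)
        then show "(case (case p of (S, T) \<Rightarrow> (T, S - T)) of (T, R) \<Rightarrow> ?g T R) = (case p of (S, T) \<Rightarrow> ?f S T)"
          unfolding p by (simp add: eqs(2) mult.assoc[symmetric])
      qed auto
      also have "\<dots> = (\<Sum>T\<in>Pow U. \<Sum>R\<in>Pow (U - T). ?g T R)"
        using True by (intro sum.Sigma[symmetric]) (auto intro: finite_subset)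
      also have "\<dots> = ?r"
        by (simp add: sum_distrib_left mult.assoc comm)
      finally show ?thesis .
    qed simp
    then show "(\<lambda>U. \<Sum>S\<in>Pow U. shuffle_sign S (U - S) *
              ((\<Sum>T\<in>Pow S. shuffle_sign T (S - T) * (x T * y (S - T))) * z (U - S))) =
          (\<lambda>U. \<Sum>T\<in>Pow U. shuffle_sign T (U - T) *
              (x T * (\<Sum>R\<in>Pow (U - T). shuffle_sign R (U - T - R) * (y R * z (U - T - R)))))"
      by blast
  qed
qed

end

text \<open>The scalar action is meaningful only if \<open>scale k 0 = 0\<close>, as in every module.\<close>

definition gscale :: "('k \<Rightarrow> 'a::ring_1 \<Rightarrow> 'a) \<Rightarrow> 'k \<Rightarrow> 'a grassmann \<Rightarrow> 'a grassmann" where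
  "gscale scale k x = Abs_grassmann (\<lambda>S. scale k (gcoeff x S))"

definition pure_tensor ::
    "('k::field \<Rightarrow> 'c::ring_1 \<Rightarrow> 'c) \<Rightarrow> 'c \<Rightarrow> 'k grassmann \<Rightarrow> 'c grassmann" where
  "pure_tensor scale c x = Abs_grassmann (\<lambda>S. scale (gcoeff x S) c)"

lift_definition gen :: "nat \<Rightarrow> 'k::field grassmann" is "\<lambda>i S. if S = {i} then 1 else 0"
  by auto

lemma gcoeff_gscale [simp]:
  assumes "\<And>k. scale k 0 = 0"
  shows "gcoeff (gscale scale k x) S = scale k (gcoeff x S)"
proof -
  have "finite {S. scale k (gcoeff x S) \<noteq> 0}"
    by (rule finite_subset[of _ "{S. gcoeff x S \<noteq> 0}"]) (use gcoeff[of x] assms in auto)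
  then show ?thesis
    using gcoeff[of x] assms unfolding gscale_def by (subst Abs_grassmann_inverse) force+
qed

lemma gcoeff_pure_tensor:
  assumes "vector_space scale"
  shows "gcoeff (pure_tensor scale c x) S = scale (gcoeff x S) c"
proof -
  interpret vector_space scale by fact
  have "finite {S. scale (gcoeff x S) c \<noteq> 0}"
    by (rule finite_subset[of _ "{S. gcoeff x S \<noteq> 0}"]) (use gcoeff[of x] in auto)
  then show ?thesis
    using gcoeff[of x] unfolding pure_tensor_def by (subst Abs_grassmann_inverse) auto
qed

lemma gen_anticommute: "gen i * gen j = - (gen j * gen i :: 'k::field grassmann)"
proof -
  have *: "gcoeff (gen i * gen j :: 'k grassmann) U =
      (if i \<noteq> j \<and> U = {i, j} then if j < i then - 1 else 1 else 0)" for i j U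
  proof (cases "finite U")
    case True
    have "gcoeff (gen i * gen j :: 'k grassmann) U =
        (\<Sum>S\<in>Pow U. if S = {i} then if U - {i} = {j} then shuffle_sign {i} {j} else 0 else 0)"
      unfolding times_grassmann.rep_eq gen.rep_eq by (rule sum.cong) auto
    also have "\<dots> = (if i \<in> U \<and> U - {i} = {j} then shuffle_sign {i} {j} else 0)"
      using True by auto
    also have "shuffle_sign {i} {j} = (if j < i then - 1 else 1 :: 'k)"
    proof -
      have "{(s, t). s \<in> {i} \<and> t \<in> {j} \<and> t < s} = (if j < i then {(i, j)} else {})" by auto
      then show ?thesis by (simp add: shuffle_sign_def inversions_def)
    qed
    also have "i \<in> U \<and> U - {i} = {j} \<longleftrightarrow> i \<noteq> j \<and> U = {i, j}" by auto
    finally show ?thesis .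
  qed (auto simp: times_grassmann.rep_eq)
  show ?thesis
    by (auto simp: gcoeff_inject[symmetric] fun_eq_iff uminus_grassmann.rep_eq * insert_commute)
qed

lemma pure_tensor_mult:
  assumes "assoc_algebra scale"
  shows "pure_tensor scale c x * pure_tensor scale d y = pure_tensor scale (c * d) (x * y)"
proof -
  interpret assoc_algebra scale by fact
  have sgn: "shuffle_sign S T * v = scale (shuffle_sign S T) v" for S T v
    by (auto simp: shuffle_sign_def minus_one_power_iff scale_minus_left)
  show ?thesis
    by (simp add: gcoeff_inject[symmetric] fun_eq_iff times_grassmann.rep_eq
        gcoeff_pure_tensor[OF vector_space_axioms] scale_sum_left scale_mult_left
        scale_mult_right sgn mult_ac)
qed

lemma assoc_algebra_gscale:
  assumes "assoc_algebra scale"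
  shows "assoc_algebra (gscale scale)"
proof -
  interpret assoc_algebra scale by fact
  show ?thesis
    by unfold_locales
      (simp_all add: gcoeff_inject[symmetric] fun_eq_iff plus_grassmann.rep_eq
        times_grassmann.rep_eq scale_right_distrib scale_left_distrib scale_sum_right
        scale_mult_left scale_mult_right)
qed

lemma gcoeff_increasing_monomial:
  assumes "sorted_wrt (<) js"
  shows "gcoeff (prod_list (map gen js) :: 'k::field grassmann) S = (if S = set js then 1 else 0)"
  using assms
proof (induction js arbitrary: S)
  case Nil
  then show ?case by (simp add: one_grassmann.rep_eq)
next
  case (Cons j js)
  have *: "shuffle_sign {j} (set js) = (1 :: 'k)"
  proof -
    have "{(s, t). s \<in> {j} \<and> t \<in> set js \<and> t < s} = {}" using Cons.prems by fastforce
    then show ?thesis unfolding shuffle_sign_def inversions_def by (simp only: card.empty power_0)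
  qed
  have j: "j \<notin> set js" using Cons.prems by auto
  have "gcoeff (prod_list (map gen (j # js)) :: 'k grassmann) S =
      (\<Sum>T\<in>Pow S. if T = {j} then if S - {j} = set js then 1 else 0 else 0)"
    unfolding list.map prod_list.Cons times_grassmann.rep_eq gen.rep_eq
  proof (rule sum.cong)
    fix T
    have "sorted_wrt (<) js" using Cons.prems by simp
    note IH = Cons.IH[OF this, of "S - T"]
    show "shuffle_sign T (S - T) * ((if T = {j} then 1 else 0) * gcoeff (prod_list (map gen js)) (S - T)) =
        (if T = {j} then if S - {j} = set js then 1 else 0 else (0 :: 'k))"
      using * unfolding IH by (cases "T = {j}"; cases "S - T = set js") simp_all
  qed simp
  also have "\<dots> = (if j \<in> S \<and> S - {j} = set js then 1 else 0)"
  proof (cases "finite S")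
    case False
    then have "S - {j} \<noteq> set js" by (metis List.finite_set finite_Diff2 finite.emptyI finite_insert)
    with False show ?thesis by simp
  qed simp
  also have "j \<in> S \<and> S - {j} = set js \<longleftrightarrow> S = set (j # js)" using j by auto
  finally show ?case .
qed

text \<open>Span of the monomials in the \<open>e\<^sub>i\<close> whose length has parity \<open>g\<close>.\<close>

definition grassmann_component :: "bit \<Rightarrow> 'k::field grassmann set" where
  "grassmann_component g =
     module.span (gscale (*)) {prod_list (map gen js) | js. of_nat (length js) = g}"

definition grassmann_envelope ::
    "('k::field \<Rightarrow> 'c::ring_1 \<Rightarrow> 'c) \<Rightarrow> (bit \<Rightarrow> 'c set) \<Rightarrow> bit \<Rightarrow> 'c grassmann set" where
  "grassmann_envelope scale G g =
     module.span (gscale scale)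
       {pure_tensor scale c x | c x. c \<in> G g \<and> x \<in> grassmann_component g}"


section \<open>Jacobson radical and graded Wedderburn--Malcev decompositions\<close>

definition left_ideal :: "'a::ring_1 set \<Rightarrow> bool" where
  "left_ideal L \<longleftrightarrow> 0 \<in> L \<and> (\<forall>x\<in>L. \<forall>y\<in>L. x + y \<in> L) \<and> (\<forall>a. \<forall>x\<in>L. a * x \<in> L)"

definition maximal_left_ideal :: "'a::ring_1 set \<Rightarrow> bool" where
  "maximal_left_ideal L \<longleftrightarrow>
     left_ideal L \<and> L \<noteq> UNIV \<and> (\<forall>M. left_ideal M \<and> L \<subseteq> M \<longrightarrow> M = L \<or> M = UNIV)"

definition jacobson_radical :: "'a::ring_1 set" where
  "jacobson_radical = \<Inter> {L. maximal_left_ideal L}"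

definition unit_of :: "'a::ring_1 set \<Rightarrow> 'a \<Rightarrow> bool" where
  "unit_of W u \<longleftrightarrow> u \<in> W \<and> (\<forall>x\<in>W. u * x = x \<and> x * u = x)"

definition alg_iso_base_field :: "('k::field \<Rightarrow> 'a::ring_1 \<Rightarrow> 'a) \<Rightarrow> 'a set \<Rightarrow> bool" where
  "alg_iso_base_field scale W \<longleftrightarrow>
     (\<exists>f. bij_betw f (UNIV :: 'k set) W \<and> (\<forall>a b. f (a + b) = f a + f b) \<and>
          (\<forall>a b. f (a * b) = f a * f b) \<and> (\<forall>k a. f (k * a) = scale k (f a)))"

context Z2_graded_algebra
begin

definition graded_subspace :: "'a set \<Rightarrow> bool" where
  "graded_subspace V \<longleftrightarrow> subspace V \<and> internal_direct_sum UNIV (\<lambda>g. V \<inter> G g) V"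

definition graded_subalgebra :: "'a set \<Rightarrow> bool" where
  "graded_subalgebra W \<longleftrightarrow> graded_subspace W \<and> (\<forall>x\<in>W. \<forall>y\<in>W. x * y \<in> W)"

definition graded_ideal_of :: "'a set \<Rightarrow> 'a set \<Rightarrow> bool" where
  "graded_ideal_of I W \<longleftrightarrow>
     graded_subspace I \<and> I \<subseteq> W \<and> (\<forall>w\<in>W. \<forall>x\<in>I. w * x \<in> I \<and> x * w \<in> I)"

definition graded_simple :: "'a set \<Rightarrow> bool" where
  "graded_simple W \<longleftrightarrow>
     graded_subalgebra W \<and> (\<exists>x\<in>W. \<exists>y\<in>W. x * y \<noteq> 0) \<and>
     (\<forall>I. graded_ideal_of I W \<longrightarrow> I = {0} \<or> I = W)"

definition graded_wedderburn_malcev :: "nat \<Rightarrow> (nat \<Rightarrow> 'a set) \<Rightarrow> bool" where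
  "graded_wedderburn_malcev n W \<longleftrightarrow>
     (\<forall>i<n. graded_simple (W i)) \<and>
     (\<forall>i<n. \<forall>j<n. i \<noteq> j \<longrightarrow> (\<forall>x\<in>W i. \<forall>y\<in>W j. x * y = 0)) \<and>
     graded_subspace jacobson_radical \<and>
     internal_direct_sum {..n} (\<lambda>i. if i < n then W i else jacobson_radical) UNIV"

definition trivially_graded_field :: "'a set \<Rightarrow> bool" where
  "trivially_graded_field W \<longleftrightarrow> W \<subseteq> G 0 \<and> alg_iso_base_field scale W"

text \<open>\<open>W = K \<oplus> cK\<close> with \<open>K\<close> in degree \<open>0\<close> and the line \<open>cK\<close> in degree \<open>1\<close>.\<close>

definition field_plus_odd_line :: "'a set \<Rightarrow> 'a \<Rightarrow> bool" where
  "field_plus_odd_line W c \<longleftrightarrow>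
     graded_subalgebra W \<and> alg_iso_base_field scale (W \<inter> G 0) \<and>
     c \<noteq> 0 \<and> W \<inter> G 1 = range (\<lambda>k. scale k c)"

end

end

theory Submission
  imports Defs
begin

text \<open>
  Minimality forces \<open>\<beta> 1 1 = - 1\<close> and \<open>\<beta> g h = 1\<close> otherwise, so that \<open>E(C)\<close> is supercommutative;
  the signs of the Grassmann generators cancel these, and \<open>C\<close> is commutative. Since \<open>A\<close> has
  nonzero products of odd elements of every length, so has \<open>C\<close>, and by finite dimensionality
  some odd element of \<open>C\<close> is not nilpotent. Write \<open>1\<close> as a sum of orthogonal primitive
  idempotents \<open>e\<close> of \<open>C\<^sub>0\<close>. Each \<open>e C\<^sub>0\<close> is \<open>K e\<close> plus nilpotents. If all odd elements of
  \<open>e C\<close> are nilpotent, then \<open>e C\<close> is \<open>K e\<close> plus nilpotents; otherwise a non-nilpotent odd element of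
  \<open>e C\<close> can be multiplied by a unit of \<open>e C\<^sub>0\<close> to give an odd \<open>c\<close> with \<open>c\<^sup>2 = e\<close>, and multiplication
  by \<open>c\<close> identifies \<open>e C\<^sub>1\<close> with \<open>e C\<^sub>0\<close>. As \<open>C\<close> is commutative, \<open>J(C)\<close> is the set of nilpotent
  elements.
\<close>

section \<open>Finite dimensional commutative algebras\<close>

definition nilpotent :: "'a::ring_1 \<Rightarrow> bool" where
  "nilpotent x \<longleftrightarrow> (\<exists>n. x ^ n = 0)"

lemma nilpotent_0 [simp]: "nilpotent 0"
  unfolding nilpotent_def by (rule exI[of _ 1]) simp

lemma idempotent_power:
  fixes e :: "'a::ring_1"
  assumes "e * e = e" and "n > 0"
  shows "e ^ n = e"
  using assms(2) by (induction n rule: nat_induct_non_zero) (auto simp: assms(1))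

lemma nilpotent_idempotent: "e * e = e \<Longrightarrow> nilpotent e \<Longrightarrow> e = 0"
  unfolding nilpotent_def by (metis idempotent_power neq0_conv power_0 mult_zero_right mult.right_neutral)

locale comm_fd_algebra = assoc_algebra scale
  for scale :: "'k::{alg_closed_field, field_char_0} \<Rightarrow> 'a::ring_1 \<Rightarrow> 'a" +
  assumes comm: "x * y = y * (x::'a)"
    and fin: "fin_dim scale"
begin

section \<open>Nilpotent elements and linear dependence\<close>

lemma left_comm: "x * (y * z) = y * (x * (z::'a))"
  by (metis comm mult.assoc)

lemmas mult_AC = comm mult.assoc left_comm

lemma power_mult_eq: "(x * y) ^ n = x ^ n * (y::'a) ^ n"
  by (induction n) (simp_all add: mult_AC)

lemma nilpotent_mult: "nilpotent x \<Longrightarrow> nilpotent (x * (y::'a))"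
proof -
  assume "nilpotent x"
  then obtain n where "x ^ n = 0" unfolding nilpotent_def by blast
  then have "(x * y) ^ n = 0" by (simp add: power_mult_eq)
  then show ?thesis unfolding nilpotent_def by blast
qed

lemma nilpotent_mult_left: "nilpotent x \<Longrightarrow> nilpotent ((y::'a) * x)"
  using nilpotent_mult[of x y] by (simp add: comm)

lemma nilpotent_scale: "nilpotent (x::'a) \<Longrightarrow> nilpotent (scale k x)"
  using nilpotent_mult_left[of x "scale k 1"] by (simp add: scale_mult_left)

lemma nilpotent_add:
  assumes "nilpotent x" and "nilpotent (y::'a)"
  shows "nilpotent (x + y)"
proof -
  \<comment> \<open>The factor \<open>z\<close> makes an induction on \<open>m + n\<close> possible:
    one factor \<open>x + y\<close> is moved onto \<open>z\<close>, and \<open>x * z\<close> is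
    killed by \<open>x ^ (m - 1)\<close> and by \<open>y ^ n\<close>, while \<open>y * z\<close> is
    killed by \<open>x ^ m\<close> and by \<open>y ^ (n - 1)\<close>.\<close>
  have *: "x ^ m * z = 0 \<Longrightarrow> y ^ n * z = 0 \<Longrightarrow> (x + y) ^ (m + n) * z = 0" for m n z
  proof (induction "m + n" arbitrary: m n z)
    case 0
    then show ?case by simp
  next
    case (Suc k)
    show ?case
    proof (cases "m = 0 \<or> n = 0")
      case True
      then show ?thesis using Suc.prems by auto
    next
      case False
      then obtain m' n' where mn: "m = Suc m'" "n = Suc n'" by (metis not0_implies_Suc)
      have p: "x ^ m' * (x * z) = 0" "y ^ n' * (y * z) = 0"
        using Suc.prems by (simp_all add: mn power_Suc2 mult.assoc del: power_Suc)
      have q: "y ^ n * (x * z) = 0" "x ^ m * (y * z) = 0"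
        using Suc.prems by (metis left_comm mult_zero_right)+
      have "(x + y) ^ (m' + n) * (x * z) = 0" "(x + y) ^ (m + n') * (y * z) = 0"
        by (rule Suc.hyps(1); use Suc.hyps(2) mn p q in simp)+
      moreover have "m' + n = m' + Suc n'" "m + n' = m' + Suc n'" using mn by simp_all
      ultimately have "(x + y) ^ (m' + Suc n') * (x * z + y * z) = 0"
        by (simp add: distrib_left)
      then have "(x + y) ^ (m' + Suc n') * ((x + y) * z) = 0" by (simp only: distrib_right)
      then show ?thesis by (simp add: mn power_Suc2 mult.assoc del: power_Suc)
    qed
  qed
  obtain m n where "x ^ m = 0" "y ^ n = 0" using assms unfolding nilpotent_def by blast
  then have "(x + y) ^ (m + n) = 0" using *[of m 1 n] by simp
  then show ?thesis unfolding nilpotent_def by blast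
qed

lemma nilpotent_uminus: "nilpotent (x::'a) \<Longrightarrow> nilpotent (- x)"
  using nilpotent_scale[of x "-1"] by simp

lemma nilpotent_diff: "nilpotent (x::'a) \<Longrightarrow> nilpotent y \<Longrightarrow> nilpotent (x - y)"
  using nilpotent_add[of x "- y"] nilpotent_uminus[of y] by simp

lemma nilpotent_sum: "(\<And>i. i \<in> I \<Longrightarrow> nilpotent (f i :: 'a)) \<Longrightarrow> nilpotent (sum f I)"
  by (induction I rule: infinite_finite_induct) (auto intro: nilpotent_add)

lemma nilpotent_scale_idempotent:
  assumes "e * e = e" "e \<noteq> 0" "nilpotent (scale k e)"
  shows "k = 0"
proof (rule ccontr)
  assume "k \<noteq> 0"
  then have "nilpotent e" using nilpotent_scale[OF assms(3), of "inverse k"] by simp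
  then show False using nilpotent_idempotent assms by blast
qed

lemma nilpotent_fixed:
  assumes "x = x * w" and "nilpotent (w::'a)"
  shows "x = 0"
proof -
  have "x = x * w ^ n" for n
  proof (induction n)
    case (Suc n)
    then show ?case using assms(1) by (metis mult.assoc power_Suc2)
  qed simp
  then show ?thesis using assms(2) unfolding nilpotent_def by (metis mult_zero_right)
qed

text \<open>The bound \<open>d\<close> is one more than the size of a finite spanning set. If no
  term lay in the span of the later ones, adding the terms from the last index downwards would keep
  them independent and distinct, giving \<open>d\<close> independent vectors. Dependence on later
  terms is the useful direction: later prefixes of a product, and higher powers of an element, have
  a common factor to take out.\<close>

lemma span_dependence: "\<exists>d. \<forall>P :: nat \<Rightarrow> 'a. \<exists>k<d. P k \<in> span (P ` {k<..<d})"
proof -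
  obtain B where B: "finite B" "span B = UNIV" using fin unfolding fin_dim_def by blast
  let ?d = "Suc (card B)"
  have "\<exists>k<?d. P k \<in> span (P ` {k<..<?d})" for P :: "nat \<Rightarrow> 'a"
  proof (rule ccontr)
    assume "\<not> ?thesis"
    then have no: "P k \<notin> span (P ` {k<..<?d})" if "k < ?d" for k using that by blast
    have "m \<le> ?d \<Longrightarrow> independent (P ` {?d - m..<?d}) \<and> card (P ` {?d - m..<?d}) = m" for m
    proof (induction m)
      case 0
      then show ?case by (simp add: independent_empty)
    next
      case (Suc m)
      let ?k = "?d - Suc m"
      have eq: "{?k..<?d} = insert ?k {?d - m..<?d}" "{?k<..<?d} = {?d - m..<?d}"
        using Suc.prems by auto
      have n: "P ?k \<notin> span (P ` {?d - m..<?d})" using no[of ?k] Suc.prems unfolding eq(2) by simp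
      then have "P ?k \<notin> P ` {?d - m..<?d}" using span_base by blast
      with n Suc show ?case
        unfolding eq(1) image_insert by (simp add: independent_insert)
    qed
    from this[of ?d] have "independent (P ` {0..<?d})" "card (P ` {0..<?d}) = ?d" by simp_all
    then show False using independent_span_bound[OF B(1), of "P ` {0..<?d}"] B(2) by simp
  qed
  then show ?thesis by blast
qed

text \<open>Take a nonzero product of length \<open>d\<close> and its prefixes \<open>P k\<close>.
  Some \<open>P k\<close> is a combination of longer prefixes, which are all multiples of
  \<open>P (Suc k) = P k * as ! k\<close>. So \<open>P k = P k * w\<close>, where \<open>w\<close>
  is a multiple of \<open>as ! k\<close>. If every element of \<open>V\<close> is nilpotent, then so
  is \<open>w\<close>, and \<open>P k\<close> vanishes together with the whole product.\<close>

lemma nonnilpotent_of_nonzero_products: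
  assumes "\<And>n. \<exists>as. length as = n \<and> set as \<subseteq> V \<and> prod_list as \<noteq> (0::'a)"
  shows "\<exists>x\<in>V. \<not> nilpotent x"
proof (rule ccontr)
  assume "\<not> ?thesis"
  then have nil: "nilpotent x" if "x \<in> V" for x using that by blast
  obtain d where d: "\<forall>P :: nat \<Rightarrow> 'a. \<exists>k<d. P k \<in> span (P ` {k<..<d})"
    using span_dependence by blast
  obtain as where as: "length as = d" "set as \<subseteq> V" "prod_list as \<noteq> 0" using assms by blast
  define P where "P k = prod_list (take k as)" for k
  obtain k where k: "k < d" "P k \<in> span (P ` {k<..<d})" using d by blast
  have step: "P (Suc k) = P k * as ! k" using k as(1) by (simp add: P_def take_Suc_conv_app_nth)
  have split: "prod_list as = P j * prod_list (drop j as)" for j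
    unfolding P_def by (metis append_take_drop_id prod_list.append)
  let ?M = "{P k * (as ! k * y) | y. True}"
  have "subspace ?M"
  proof (rule subspaceI)
    show "0 \<in> ?M" by (auto intro: exI[of _ 0])
    fix x y c assume x: "x \<in> ?M"
    from x obtain x' where x': "x = P k * (as ! k * x')" by blast
    show "scale c x \<in> ?M" using x' by (auto simp: scale_mult_right[symmetric])
    assume "y \<in> ?M"
    then obtain y' where "y = P k * (as ! k * y')" by blast
    then have "x + y = P k * (as ! k * (x' + y'))" using x' by (simp add: distrib_left)
    then show "x + y \<in> ?M" by blast
  qed
  moreover have "P ` {k<..<d} \<subseteq> ?M"
  proof
    fix x assume "x \<in> P ` {k<..<d}"
    then obtain j where j: "x = P j" "k < j" by auto
    have "take j as = take (Suc k) as @ drop (Suc k) (take j as)"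
      using j(2) by (metis append_take_drop_id min.absorb1 Suc_leI take_take)
    then have "P j = P (Suc k) * prod_list (drop (Suc k) (take j as))"
      unfolding P_def by (metis prod_list.append)
    then show "x \<in> ?M" using j step by (auto simp: mult.assoc)
  qed
  ultimately have "P k \<in> ?M" using k(2) span_minimal by blast
  then obtain y where "P k = P k * (as ! k * y)" by blast
  moreover have "nilpotent (as ! k * y)" 
  proof (rule nilpotent_mult)
    have "as ! k \<in> set as" using as(1) k(1) by simp
    then show "nilpotent (as ! k)" using nil as(2) by blast
  qed
  ultimately have "P k = 0" by (rule nilpotent_fixed)
  then show False using split[of k] as(3) by simp
qed


subsection \<open>Evaluation of polynomials\<close>

text \<open>Horner's scheme, with coefficients in the base field and the point in the
  algebra.\<close>

definition peval :: "'k poly \<Rightarrow> 'a \<Rightarrow> 'a" where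
  "peval p a = fold_coeffs (\<lambda>k y. scale k 1 + a * y) p 0"

lemma peval_0 [simp]: "peval 0 a = 0"
  by (simp add: peval_def)

lemma peval_pCons [simp]: "peval (pCons c p) a = scale c 1 + a * peval p a"
  by (cases "p = 0"; cases "c = 0") (auto simp: peval_def)

lemma peval_add [simp]: "peval (p + q) a = peval p a + peval q a"
proof (induction p arbitrary: q)
  case (pCons c p)
  show ?case by (cases q) (simp add: pCons.IH scale_left_distrib distrib_left)
qed simp

lemma peval_smult [simp]: "peval (smult k p) a = scale k (peval p a)"
  by (induction p) (simp_all add: scale_right_distrib scale_mult_right)

lemma peval_minus [simp]: "peval (- p) a = - peval p a"
  using peval_smult[of "-1" p a] by simp

lemma peval_diff [simp]: "peval (p - q) a = peval p a - peval q a"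
  using peval_add[of p "- q" a] by simp

lemma peval_mult [simp]: "peval (p * q) a = peval p a * peval q a"
  by (induction p) (simp_all add: distrib_right scale_mult_left mult.assoc)

lemma peval_monom [simp]: "peval (monom 1 n) a = a ^ n"
  by (induction n) (simp_all add: monom_Suc monom_0)

definition unital_subalgebra :: "'a set \<Rightarrow> bool" where
  "unital_subalgebra S \<longleftrightarrow> subspace S \<and> 1 \<in> S \<and> (\<forall>x\<in>S. \<forall>y\<in>S. x * y \<in> S)"

lemma unital_subalgebra_power: "unital_subalgebra S \<Longrightarrow> x \<in> S \<Longrightarrow> x ^ n \<in> S"
  by (induction n) (auto simp: unital_subalgebra_def)

lemma peval_in_subalgebra: "unital_subalgebra S \<Longrightarrow> a \<in> S \<Longrightarrow> peval p a \<in> S"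
  by (induction p)
    (auto simp: unital_subalgebra_def subspace_0 intro!: subspace_add subspace_scale)

text \<open>Some power of \<open>a\<close> is a combination of higher powers, from which
  \<open>a ^ Suc k\<close> can be taken out. This one relation yields both an annihilating
  polynomial and the idempotent in Fitting's lemma.\<close>

lemma power_dependence: "\<exists>k q. a ^ k = a ^ Suc k * peval q a"
proof -
  obtain d where d: "\<forall>P :: nat \<Rightarrow> 'a. \<exists>k<d. P k \<in> span (P ` {k<..<d})"
    using span_dependence by blast
  then obtain k where k: "a ^ k \<in> span ((\<lambda>j. a ^ j) ` {k<..<d})" by blast
  let ?M = "{a ^ Suc k * peval q a | q. True}"
  have "subspace ?M"
  proof (rule subspaceI)
    show "0 \<in> ?M" by (auto intro: exI[of _ 0])
    fix x y c assume x: "x \<in> ?M"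
    from x obtain x' where x': "x = a ^ Suc k * peval x' a" by blast
    then have "scale c x = a ^ Suc k * peval (smult c x') a"
      by (simp add: scale_mult_right del: power_Suc)
    then show "scale c x \<in> ?M" by blast
    assume "y \<in> ?M"
    then obtain y' where "y = a ^ Suc k * peval y' a" by blast
    then have "x + y = a ^ Suc k * peval (x' + y') a"
      using x' by (simp add: distrib_left del: power_Suc)
    then show "x + y \<in> ?M" by blast
  qed
  moreover have "(\<lambda>j. a ^ j) ` {k<..<d} \<subseteq> ?M"
  proof
    fix x assume "x \<in> (\<lambda>j. a ^ j) ` {k<..<d}"
    then obtain j where j: "x = a ^ j" "k < j" by auto
    then have "x = a ^ Suc k * peval (monom 1 (j - Suc k)) a"
      by (simp add: power_add[symmetric] del: power_Suc)
    then show "x \<in> ?M" by blast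
  qed
  ultimately have "a ^ k \<in> ?M" using k span_minimal by blast
  then show ?thesis by blast
qed

lemma annihilating_poly: "\<exists>p. p \<noteq> 0 \<and> peval p a = 0"
proof -
  obtain k q where kq: "a ^ k = a ^ Suc k * peval q a" using power_dependence by blast
  let ?p = "monom 1 k - monom 1 (Suc k) * q"
  have "coeff (monom 1 (Suc k) * q) k = 0" by (simp only: coeff_monom_mult) simp
  then have "coeff ?p k = 1" by simp
  then have "?p \<noteq> 0" by force
  moreover have "peval ?p a = 0" using kq by (simp del: power_Suc)
  ultimately show ?thesis by blast
qed

text \<open>Fitting's lemma: \<open>f\<close> is the projection onto the part on which \<open>x\<close> is invertible.\<close>

lemma fitting_idempotent:
  assumes S: "unital_subalgebra S" and x: "x \<in> S"
  shows "\<exists>f\<in>S. \<exists>y\<in>S. \<exists>n. f * f = f \<and> f = x * y \<and> x ^ n = x ^ n * f"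
proof -
  obtain k q where kq: "x ^ k = x ^ Suc k * peval q x" using power_dependence by blast
  define r where "r = peval q x"
  \<comment> \<open>The exponent is positive even if \<open>k = 0\<close>, so that a factor
    \<open>x\<close> can be split off from \<open>x ^ n * r ^ n\<close>.\<close>
  define n where "n = Suc k"
  have n1: "x ^ n = x ^ Suc n * r"
  proof -
    have "x ^ n = x * x ^ k" unfolding n_def by simp
    also have "\<dots> = x * (x ^ Suc k * r)" unfolding r_def by (subst kq) (rule refl)
    also have "\<dots> = x ^ Suc n * r" unfolding n_def by (simp add: mult.assoc)
    finally show ?thesis .
  qed
  \<comment> \<open>For \<open>m = n\<close> this says \<open>x ^ n = x ^ n * f\<close> with
    \<open>f = x ^ n * r ^ n\<close>; multiplication by \<open>r ^ n\<close> then gives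
    \<open>f = f * f\<close>.\<close>
  have "x ^ n = x ^ (n + m) * r ^ m" for m
  proof (induction m)
    case 0
    then show ?case by simp
  next
    case (Suc m)
    have "x ^ (n + m) = x ^ m * x ^ n" by (metis add.commute power_add)
    also have "\<dots> = x ^ (n + Suc m) * r" by (subst n1) (simp add: power_add mult_AC)
    finally have "x ^ (n + m) * r ^ m = x ^ (n + Suc m) * r * r ^ m" by (simp only:)
    also have "\<dots> = x ^ (n + Suc m) * r ^ Suc m" by (simp only: power_Suc mult.assoc)
    finally show ?case using Suc by (simp only:)
  qed
  then have n2: "x ^ n = x ^ n * (x ^ n * r ^ n)" by (metis mult.assoc power_add)
  let ?f = "x ^ n * r ^ n"
  have rS: "r \<in> S" unfolding r_def using peval_in_subalgebra S x by blast
  have S': "y * z \<in> S" if "y \<in> S" "z \<in> S" for y z using S that unfolding unital_subalgebra_def by blast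
  have "?f = x * (x ^ k * r ^ n)" unfolding n_def by (simp add: mult.assoc)
  moreover have "?f * ?f = ?f"
  proof -
    have "?f * ?f = x ^ n * ?f * r ^ n" by (simp only: mult_AC)
    also have "\<dots> = ?f" by (simp only: n2[symmetric])
    finally show ?thesis .
  qed
  moreover have "x ^ k * r ^ n \<in> S" "?f \<in> S"
    using S' unital_subalgebra_power[OF S] x rS by blast+
  ultimately show ?thesis using n2 by blast
qed


subsection \<open>Primitive idempotents\<close>

text \<open>The condition \<open>e * f = f\<close> is the usual order \<open>f \<le> e\<close> on
  idempotents. Primitivity is relative to \<open>S\<close>, which is later the even component or the
  whole algebra.\<close>

definition primitive_idempotent :: "'a set \<Rightarrow> 'a \<Rightarrow> bool" where
  "primitive_idempotent S e \<longleftrightarrow> e \<in> S \<and> e * e = e \<and> e \<noteq> 0 \<and>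
     (\<forall>f\<in>S. f * f = f \<and> e * f = f \<longrightarrow> f = 0 \<or> f = e)"

text \<open>The ring \<open>e S\<close> is local. The Fitting idempotent \<open>f\<close> of
  \<open>x\<close> gives an idempotent \<open>f * e\<close> below \<open>e\<close>, which must be
  \<open>0\<close> or \<open>e\<close>: in the first case \<open>x\<close> is nilpotent on
  \<open>e\<close>, in the second it is invertible there.\<close>

lemma primitive_dichotomy:
  assumes S: "unital_subalgebra S" and e: "primitive_idempotent S e" and x: "x \<in> S"
  shows "nilpotent (x * e) \<or> (\<exists>y\<in>S. x * y * e = e)"
proof -
  obtain f y n where f: "f \<in> S" "y \<in> S" "f * f = f" "f = x * y" "x ^ n = x ^ n * f"
    using fitting_idempotent[OF S x] by blast
  have ee: "e * e = e" and eS: "e \<in> S" using e unfolding primitive_idempotent_def by auto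
  have "f * e \<in> S" using S f eS unfolding unital_subalgebra_def by blast
  moreover have "(f * e) * (f * e) = f * e" "e * (f * e) = f * e"
    by (metis comm mult.assoc ee f(3))+
  ultimately consider "f * e = 0" | "f * e = e" using e unfolding primitive_idempotent_def by blast
  then show ?thesis
  proof cases
    case 1
    have "(x * e) ^ Suc n = x * e ^ n * (x ^ n * (f * e))"
      using f(5) by (simp add: power_mult_eq mult_AC)
    then show ?thesis using 1 unfolding nilpotent_def by (metis mult_zero_right)
  next
    case 2
    then show ?thesis using f by metis
  qed
qed

text \<open>The residue field of \<open>e S\<close> is the base field, which is algebraically
  closed. Take \<open>p\<close> of least degree with \<open>p(x) e = 0\<close>, a root
  \<open>l\<close> of \<open>p\<close>, and \<open>p = (X - l) q\<close>. By minimality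
  \<open>q(x) e\<close> is nonzero, and \<open>x - l\<close> kills it; hence \<open>x - l\<close> is
  not invertible on \<open>e\<close>, and the dichotomy leaves only nilpotency.\<close>

lemma primitive_eigenvalue:
  assumes S: "unital_subalgebra S" and e: "primitive_idempotent S e" and x: "x \<in> S"
  shows "\<exists>l. nilpotent (x * e - scale l e)"
proof -
  have e0: "e \<noteq> 0" using e unfolding primitive_idempotent_def by blast
  let ?P = "\<lambda>p. p \<noteq> 0 \<and> peval p x * e = 0"
  obtain p0 where "?P p0" using annihilating_poly[of x] by (metis mult_zero_left)
  then obtain p where p: "?P p" and least: "\<And>q. ?P q \<Longrightarrow> degree p \<le> degree q"
    using ex_has_least_nat[of ?P p0 degree] by blast
  have "degree p > 0"
  proof (rule ccontr)
    assume "\<not> degree p > 0"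
    then obtain c where "p = [:c:]" using degree_eq_zeroE by blast
    then show False using p e0 by (simp add: scale_mult_left)
  qed
  then obtain l where "poly p l = 0" using alg_closed_imp_poly_has_root by blast
  then obtain q where q: "p = [:- l, 1:] * q" by (metis dvdE poly_eq_0_iff_dvd)
  then have q0: "q \<noteq> 0" using p by auto
  then have "degree p = Suc (degree q)" unfolding q by (subst degree_mult_eq) auto
  then have qe: "peval q x * e \<noteq> 0" using least[of q] q0 by auto
  let ?z = "x - scale l 1"
  have zS: "?z \<in> S" using S x unfolding unital_subalgebra_def
    by (auto intro!: subspace_diff subspace_scale)
  have "peval p x = ?z * peval q x" unfolding q by (simp add: left_diff_distrib scale_mult_left)
  then have z: "?z * (peval q x * e) = 0" using p by (simp add: mult.assoc)
  have "nilpotent (?z * e)"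
    using primitive_dichotomy[OF S e zS]
  proof
    assume "\<exists>y\<in>S. ?z * y * e = e"
    then obtain y where "?z * y * e = e" by blast
    then have "peval q x * e = y * (?z * (peval q x * e))" by (metis comm mult.assoc)
    then show ?thesis using z qe by simp
  qed
  then show ?thesis by (auto simp: left_diff_distrib scale_mult_left)
qed

lemma orthogonal_idempotents_independent:
  assumes "finite F" "\<And>e. e \<in> F \<Longrightarrow> e * e = e \<and> e \<noteq> 0"
    and "\<And>e f. e \<in> F \<Longrightarrow> f \<in> F \<Longrightarrow> e \<noteq> f \<Longrightarrow> e * f = 0"
  shows "independent F"
proof (rule independent_if_scalars_zero[OF assms(1)])
  fix u e assume s: "(\<Sum>x\<in>F. scale (u x) x) = 0" and e: "e \<in> F"
  have "0 = e * (\<Sum>x\<in>F. scale (u x) x)" using s by simp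
  also have "\<dots> = (\<Sum>x\<in>F. if x = e then scale (u e) e else 0)"
    unfolding sum_distrib_left using assms e by (intro sum.cong) (auto simp: scale_mult_right)
  also have "\<dots> = scale (u e) e" using assms(1) e by simp
  finally show "u e = 0" using assms(2)[OF e] by simp
qed

text \<open>Orthogonal nonzero idempotents are independent, so a system of them with sum
  \<open>1\<close> has bounded size. In a system of greatest size each member is primitive, since
  otherwise some \<open>e\<close> could be replaced by \<open>f\<close> and
  \<open>e - f\<close>.\<close>

lemma primitive_decomposition:
  assumes S: "unital_subalgebra S"
  shows "\<exists>F. finite F \<and> (\<forall>e\<in>F. primitive_idempotent S e) \<and>
           (\<forall>e\<in>F. \<forall>f\<in>F. e \<noteq> f \<longrightarrow> e * f = 0) \<and> \<Sum>F = 1"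
proof -
  obtain B where B: "finite B" "span B = UNIV" using fin unfolding fin_dim_def by blast
  define Q where "Q F \<longleftrightarrow> finite F \<and> (\<forall>e\<in>F. e \<in> S \<and> e * e = e \<and> e \<noteq> 0) \<and>
           (\<forall>e\<in>F. \<forall>f\<in>F. e \<noteq> f \<longrightarrow> e * f = 0) \<and> \<Sum>F = 1" for F
  have "Q {1}" using S unfolding unital_subalgebra_def Q_def by simp
  moreover have "\<forall>F. Q F \<longrightarrow> card F < Suc (card B)"
  proof (intro allI impI)
    fix F assume "Q F"
    then have "independent F" unfolding Q_def by (intro orthogonal_idempotents_independent) auto
    from independent_span_bound[OF B(1) this] have "card F \<le> card B" by (simp add: B(2))
    then show "card F < Suc (card B)" by (rule le_imp_less_Suc)
  qed
  ultimately obtain F where QF: "Q F" and max: "\<And>F'. Q F' \<Longrightarrow> card F' \<le> card F"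
    using ex_has_greatest_nat[of Q "{1}" card "Suc (card B)"] by blast
  have F: "finite F" "\<Sum>F = 1" and FS: "\<And>e. e \<in> F \<Longrightarrow> e \<in> S \<and> e * e = e \<and> e \<noteq> 0"
    and orth: "\<And>e f. e \<in> F \<Longrightarrow> f \<in> F \<Longrightarrow> e \<noteq> f \<Longrightarrow> e * f = 0"
    using QF unfolding Q_def by simp_all
  have "primitive_idempotent S e" if e: "e \<in> F" for e
  proof (rule ccontr)
    assume "\<not> ?thesis"
    then obtain f where f: "f \<in> S" "f * f = f" "e * f = f" "f \<noteq> 0" "f \<noteq> e"
      using FS[OF e] unfolding primitive_idempotent_def by blast
    have ee: "e * e = e" "e \<in> S" using FS[OF e] by simp_all
    have fe: "f * e = f" using f(3) comm by simp
    let ?g = "e - f" let ?R = "F - {e}"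
    have finR: "finite ?R" using F(1) by simp
    have eR: "e * h = 0" "h * e = 0" if "h \<in> ?R" for h
      using orth[OF e, of h] orth[of h e] e that by auto
    have fR: "f * h = 0" "h * f = 0" if "h \<in> ?R" for h
      using eR[OF that] fe f(3) by (metis mult.assoc mult_zero_left mult_zero_right)+
    have g: "?g \<in> S" "?g * ?g = ?g" "?g \<noteq> 0" "f * ?g = 0" "?g * f = 0" "e * ?g = ?g"
      using S f(1,5) ee(2) unfolding unital_subalgebra_def
      by (simp_all add: left_diff_distrib right_diff_distrib subspace_diff f(2,3) ee(1) fe)
    \<comment> \<open>The two new members differ from each other and from all the remaining ones, so
      that the replacement raises the cardinality by exactly one.\<close>
    have fg: "f \<noteq> ?g" using g(4) f(2,4) by metis
    have fn: "f \<notin> ?R" using eR(1)[of f] f(3,4) by metis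
    have gn: "?g \<notin> ?R" using eR(1)[of ?g] g(3,6) by metis
    let ?F = "insert f (insert ?g ?R)"
    have "\<Sum>?F = f + (?g + \<Sum>?R)" using finR fg fn gn by (simp del: insert_Diff_single)
    also have "\<dots> = e + \<Sum>?R" by simp
    also have "\<dots> = \<Sum>F" using F e by (metis sum.remove)
    finally have "\<Sum>?F = 1" using F by metis
    moreover have "a * b = 0" if "a \<in> ?F" "b \<in> ?F" "a \<noteq> b" for a b
    proof -
      have gR: "?g * h = 0" "h * ?g = 0" if "h \<in> ?R" for h
        using eR[OF that] fR[OF that] by (simp_all add: left_diff_distrib right_diff_distrib)
      have "h * h' = 0" if "h \<in> ?R" "h' \<in> ?R" "h \<noteq> h'" for h h'
        using orth[of h h'] that by simp
      then show ?thesis using that fR gR g(4,5) by (elim insertE) simp_all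
    qed
    moreover have "a \<in> S \<and> a * a = a \<and> a \<noteq> 0" if "a \<in> ?F" for a
      using that FS[of a] f(1,2,4) g(1-3) by (elim insertE) simp_all
    ultimately have "Q ?F" unfolding Q_def using finR by simp
    from max[OF this] have "card ?F \<le> card F" .
    moreover have "card ?F = Suc (Suc (card ?R))" using finR fg fn gn by (simp del: insert_Diff_single)
    moreover have "card F = Suc (card ?R)" using F e by (metis card_Suc_Diff1)
    ultimately show False by simp
  qed
  then show ?thesis using F orth by (intro exI[of _ F]) simp
qed

text \<open>For a primitive idempotent \<open>f\<close> of the whole algebra, the elements that are
  nilpotent on \<open>f\<close> form a maximal left ideal. An element \<open>x\<close> of the
  radical lies in all of these, and it is the sum of the \<open>x * f\<close>. Conversely, if a
  nilpotent \<open>x\<close> were outside a maximal left ideal \<open>M\<close>, then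
  \<open>1 = m + y * x\<close> with \<open>m\<close> in \<open>M\<close>, and
  \<open>1 - (y * x) ^ n\<close>, a multiple of \<open>m\<close>, would lie in \<open>M\<close> for
  all \<open>n\<close>; but \<open>y * x\<close> is nilpotent.\<close>

lemma jacobson_radical_eq: "jacobson_radical = {x::'a. nilpotent x}"
proof (rule set_eqI, simp, rule iffI)
  fix x :: 'a assume x: "x \<in> jacobson_radical"
  have U: "unital_subalgebra (UNIV::'a set)" unfolding unital_subalgebra_def by simp
  obtain F where F: "finite F" "\<forall>e\<in>F. primitive_idempotent UNIV e" "\<Sum>F = 1"
    using primitive_decomposition[OF U] by blast
  have "nilpotent (x * f)" if f: "f \<in> F" for f
  proof -
    have p: "primitive_idempotent UNIV f" using F f by blast
    have ff: "f * f = f" "f \<noteq> 0" using p unfolding primitive_idempotent_def by auto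
    let ?M = "{x::'a. nilpotent (x * f)}"
    have "left_ideal ?M" unfolding left_ideal_def
      by (auto simp: distrib_right mult.assoc intro: nilpotent_add nilpotent_mult_left)
    moreover have "?M \<noteq> UNIV"
    proof -
      have "1 \<notin> ?M" using nilpotent_idempotent[OF ff(1)] ff(2) by auto
      then show ?thesis by blast
    qed
    moreover have "M = ?M \<or> M = UNIV" if M: "left_ideal M" "?M \<subseteq> M" for M
    proof (rule disjCI)
      assume "M \<noteq> UNIV"
      have add: "a + b \<in> M" if "a \<in> M" "b \<in> M" for a b using M that unfolding left_ideal_def by blast
      have mul: "b * a \<in> M" if "a \<in> M" for a b using M that unfolding left_ideal_def by blast
      \<comment> \<open>Otherwise \<open>z\<close> is invertible on \<open>f\<close>, which puts
        \<open>f\<close> into \<open>M\<close>. Since \<open>(1 - f) * f = 0\<close>, also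
        \<open>1 - f\<close> lies in \<open>?M\<close> and so in \<open>M\<close>, and
        \<open>M\<close> contains \<open>1\<close>.\<close>
      have "z \<in> ?M" if z: "z \<in> M" for z
      proof (rule ccontr)
        assume "z \<notin> ?M"
        then obtain y where "z * y * f = f" using primitive_dichotomy[OF U p, of z] by blast
        then have "f = (y * f) * z" by (simp add: mult_AC)
        then have "f \<in> M" using mul[OF z, of "y * f"] by simp
        moreover have "1 - f \<in> M" using M(2) ff by (auto simp: left_diff_distrib)
        ultimately have "1 \<in> M" using add[of f "1 - f"] by simp
        then have "M = UNIV" using mul[of 1] by auto
        then show False using \<open>M \<noteq> UNIV\<close> by blast
      qed
      then show "M = ?M" using M(2) by blast
    qed
    ultimately have "maximal_left_ideal ?M" unfolding maximal_left_ideal_def by blast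
    then have "x \<in> ?M" using x unfolding jacobson_radical_def by blast
    then show ?thesis by simp
  qed
  then have "nilpotent (\<Sum>f\<in>F. x * f)" by (rule nilpotent_sum)
  then show "nilpotent x" using F(3) by (simp add: sum_distrib_left[symmetric])
next
  fix x :: 'a assume x: "nilpotent x"
  have "x \<in> M" if M: "maximal_left_ideal M" for M
  proof (rule ccontr)
    assume xM: "x \<notin> M"
    have lM: "left_ideal M" "M \<noteq> UNIV" using M unfolding maximal_left_ideal_def by blast+
    have mul: "b * a \<in> M" if "a \<in> M" for a b using lM that unfolding left_ideal_def by blast
    have add: "a + b \<in> M" if "a \<in> M" "b \<in> M" for a b using lM that unfolding left_ideal_def by blast
    have "0 \<in> M" using lM unfolding left_ideal_def by blast
    let ?N = "{m + y * x | m y. m \<in> M}"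
    have "left_ideal ?N" unfolding left_ideal_def
    proof (intro conjI ballI allI)
      show "0 \<in> ?N" using \<open>0 \<in> M\<close> by (auto intro!: exI[of _ 0])
      fix u b assume "u \<in> ?N"
      then obtain m y where u: "m \<in> M" "u = m + y * x" by blast
      have "b * u = b * m + (b * y) * x" using u by (simp add: distrib_left mult.assoc)
      then show "b * u \<in> ?N" using mul[OF u(1)] by blast
      fix v assume "v \<in> ?N"
      then obtain m' y' where v: "m' \<in> M" "v = m' + y' * x" by blast
      have "u + v = (m + m') + (y + y') * x" using u v by (simp add: distrib_right)
      then show "u + v \<in> ?N" using add[OF u(1) v(1)] by blast
    qed
    moreover have "M \<subseteq> ?N"
    proof
      fix m assume "m \<in> M"
      then have "m = m + 0 * x \<and> m \<in> M" by simp
      then show "m \<in> ?N" by blast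
    qed
    moreover have "x \<in> ?N"
    proof -
      have "x = 0 + 1 * x" by simp
      with \<open>0 \<in> M\<close> show ?thesis by blast
    qed
    ultimately have "?N = UNIV" using M xM unfolding maximal_left_ideal_def by blast
    then have "1 \<in> ?N" by simp
    then obtain m y where my: "m \<in> M" "1 = m + y * x" by blast
    have "1 - (y * x) ^ n \<in> M" for n
    proof (induction n)
      case (Suc n)
      have "1 - (y * x) ^ Suc n = (1 - (y * x) ^ n) + (y * x) ^ n * (1 - y * x)"
        by (simp add: right_diff_distrib power_Suc2 del: power_Suc)
      also have "1 - y * x = m" using my(2) by (metis add_diff_cancel_right')
      finally have eq: "1 - (y * x) ^ Suc n = (1 - (y * x) ^ n) + (y * x) ^ n * m" .
      show ?case unfolding eq using Suc mul[OF my(1)] by (rule add)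
    qed (simp add: \<open>0 \<in> M\<close>)
    moreover obtain n where "(y * x) ^ n = 0"
      using nilpotent_mult_left[OF x] unfolding nilpotent_def by blast
    ultimately have "1 \<in> M" by (metis diff_zero)
    then have "M = UNIV" using mul[of 1] by auto
    then show False using lM by blast
  qed
  then show "x \<in> jacobson_radical" unfolding jacobson_radical_def by blast
qed

text \<open>Newton's iteration for the square root: if \<open>c\<^sup>2 = e + z\<close>, then \<open>c (1 - z / 2)\<close> has square
  \<open>e + z\<^sup>2 (z - 3 e) / 4\<close>.\<close>

lemma sqrt_idempotent:
  assumes S: "unital_subalgebra S" "e \<in> S" "z \<in> S"
    and "e * e = e" and "e * c = c" and "c * c = e + z" and "nilpotent z"
  shows "\<exists>u\<in>S. (u * c) * (u * c) = e"
proof -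
  have "e * z = z"
  proof -
    have "e * (c * c) = c * c" using assms(5) by (metis mult.assoc)
    then show ?thesis using assms(4,6) by (simp add: distrib_left)
  qed
  obtain m where "z ^ m = 0" using assms(7) unfolding nilpotent_def by blast
  then show ?thesis using assms(5,6) \<open>e * z = z\<close> S(3)
  proof (induction m arbitrary: c z rule: less_induct)
    case (less m)
    show ?case
    proof (cases "m \<le> 1")
      case True
      then have "z = 0" using less.prems(1)
      proof (cases "m = 0")
        case True
        then have "1 = (0::'a)" using less.prems(1) by simp
        then show ?thesis by simp
      next
        case False
        with True have "m = 1" by simp
        then show ?thesis using less.prems(1) by simp
      qed
      then show ?thesis using less.prems
        using S by (intro bexI[of _ 1]) (auto simp: unital_subalgebra_def)
    next
      case False
      \<comment> \<open>With \<open>t\<close> as the Newton factor, \<open>z * z * w\<close> is the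
        error term of the next step, and the even smaller nilpotency exponent found below lets the
        induction continue.\<close>
      define t where "t = 1 - scale (1/2) z"
      define w where "w = scale (1/4) (z - scale 3 e)"
      have sq: "t * t = 1 - z + scale (1/4) (z * z)"
      proof -
        have "t * t = 1 - (scale (1/2) z + scale (1/2) z) + scale (1/4) (z * z)"
          unfolding t_def
          by (simp add: left_diff_distrib right_diff_distrib scale_mult_left scale_mult_right scale_right_diff_distrib)
        also have "scale (1/2) z + scale (1/2) z = z"
          by (simp add: scale_left_distrib[symmetric])
        finally show ?thesis .
      qed
      have ze: "z * e = z" using less.prems comm by simp
      have "(t * c) * (t * c) = (t * t) * (c * c)" by (simp add: mult_AC)
      also have "\<dots> = e + (scale (1/4) (z * (z * z)) - (z * z - scale (1/4) (z * z)))"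
        unfolding sq less.prems(3)
        by (simp add: left_diff_distrib distrib_right distrib_left scale_mult_left ze mult.assoc algebra_simps)
      also have "z * z - scale (1/4) (z * z) = scale (3/4) (z * z)"
        using scale_left_diff_distrib[of 1 "1/4" "z * z"] by simp
      also have "scale (1/4) (z * (z * z)) - scale (3/4) (z * z) = z * z * w"
        unfolding w_def
        by (simp add: right_diff_distrib scale_mult_right scale_right_diff_distrib mult.assoc ze)
      finally have tc: "(t * c) * (t * c) = e + z * z * w" .
      \<comment> \<open>Since \<open>m \<ge> 2\<close>, the exponent \<open>2 * (m - 1)\<close> of
        \<open>z\<close> is at least \<open>m\<close>; so the exponent that kills the error drops
        from \<open>m\<close> to \<open>m - 1\<close>.\<close>
      have "(z * z * w) ^ (m - 1) = z ^ m * (z ^ (m - 2) * w ^ (m - 1))"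
      proof -
        have "m - 1 + (m - 1) = m + (m - 2)" using False by simp
        then have "z ^ (m - 1) * z ^ (m - 1) = z ^ m * z ^ (m - 2)" by (metis power_add)
        then show ?thesis by (simp add: power_mult_eq mult_AC)
      qed
      then have "(z * z * w) ^ (m - 1) = 0" using less.prems by simp
      moreover have "e * (t * c) = t * c" using less.prems(2) by (metis left_comm)
      moreover have "e * (z * z * w) = z * z * w" using less.prems(4) by (metis mult.assoc)
      moreover have tS: "t \<in> S" and "z * z * w \<in> S"
        unfolding t_def w_def using S \<open>z \<in> S\<close> unfolding unital_subalgebra_def
        by (auto intro!: subspace_diff subspace_scale)
      ultimately obtain u where u: "u \<in> S" "(u * (t * c)) * (u * (t * c)) = e"
        using less.IH[of "m - 1" "z * z * w" "t * c"] False tc by auto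
      then show ?thesis
        using S tS unfolding unital_subalgebra_def by (intro bexI[of _ "u * t"]) (auto simp: mult.assoc)
    qed
  qed
qed

end


section \<open>Graded commutative algebras\<close>

lemma UNIV_bit: "(UNIV :: bit set) = {0, 1}"
proof -
  have "x = 0 \<or> x = 1" for x :: bit by (cases x) auto
  then show ?thesis by auto
qed

text \<open>Because the summands are closed under differences, uniqueness need only be checked for
  the decomposition of \<open>0\<close>. Restricting a family to \<open>I\<close> makes it
  extensional.\<close>

lemma internal_direct_sumI:
  fixes V :: "'i \<Rightarrow> 'a::ab_group_add set"
  assumes sub: "\<And>i. i \<in> I \<Longrightarrow> V i \<subseteq> U"
    and diff: "\<And>i x y. i \<in> I \<Longrightarrow> x \<in> V i \<Longrightarrow> y \<in> V i \<Longrightarrow> x - y \<in> V i"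
    and ex: "\<And>x. x \<in> U \<Longrightarrow> \<exists>v. (\<forall>i\<in>I. v i \<in> V i) \<and> x = (\<Sum>i\<in>I. v i)"
    and indep: "\<And>v i. (\<And>i. i \<in> I \<Longrightarrow> v i \<in> V i) \<Longrightarrow> (\<Sum>i\<in>I. v i) = 0 \<Longrightarrow> i \<in> I \<Longrightarrow> v i = 0"
  shows "internal_direct_sum I V U"
  unfolding internal_direct_sum_def
proof (intro conjI ballI ex_ex1I)
  fix x assume "x \<in> U"
  then obtain v where v: "\<forall>i\<in>I. v i \<in> V i" "x = (\<Sum>i\<in>I. v i)" using ex by blast
  then show "\<exists>v. v \<in> extensional I \<and> (\<forall>i\<in>I. v i \<in> V i) \<and> x = (\<Sum>i\<in>I. v i)"
    by (intro exI[of _ "restrict v I"]) simp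
next
  fix x v w
  assume v: "v \<in> extensional I \<and> (\<forall>i\<in>I. v i \<in> V i) \<and> x = (\<Sum>i\<in>I. v i)"
    and w: "w \<in> extensional I \<and> (\<forall>i\<in>I. w i \<in> V i) \<and> x = (\<Sum>i\<in>I. w i)"
  have "(\<Sum>i\<in>I. v i - w i) = 0" using v w by (simp add: sum_subtractf)
  then have "v i - w i = 0" if "i \<in> I" for i
    using indep[of "\<lambda>i. v i - w i" i] diff v w that by blast
  then show "v = w" using v w by (intro extensionalityI[of v I w]) auto
qed (use sub in auto)

context Z2_graded_algebra
begin

lemma homogeneous_decomposition: "\<exists>a\<in>G 0. \<exists>b\<in>G 1. x = a + b"
proof -
  obtain v where "\<forall>i. v i \<in> G i" "x = (\<Sum>i\<in>UNIV. v i)"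
    using components_direct unfolding internal_direct_sum_def by blast
  then show ?thesis by (auto simp: UNIV_bit)
qed

lemma homogeneous_eq_0:
  assumes "a \<in> G 0" and "b \<in> G 1" and "a + b = 0"
  shows "a = 0 \<and> b = 0"
proof -
  have "\<exists>!v. v \<in> extensional UNIV \<and> (\<forall>i\<in>UNIV. v i \<in> G i) \<and> 0 = (\<Sum>i\<in>UNIV. v i)"
    using components_direct unfolding internal_direct_sum_def by blast
  then have u: "v = w" if "\<forall>i. v i \<in> G i" "0 = (\<Sum>i\<in>UNIV. v i)" "\<forall>i. w i \<in> G i" "0 = (\<Sum>i\<in>UNIV. w i)"
    for v w using that by auto
  have "(\<lambda>g::bit. if g = 0 then a else b) = (\<lambda>_. 0)"
  proof (rule u)
    show "\<forall>i. (if i = 0 then a else b) \<in> G i" using assms UNIV_bit by auto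
    show "0 = (\<Sum>i\<in>(UNIV::bit set). if i = 0 then a else b)" using assms by (simp add: UNIV_bit)
  qed (auto simp: subspace_0 component_subspace)
  then have "(if g = 0 then a else b) = 0" for g :: bit by meson
  from this[of 0] this[of 1] show ?thesis by simp
qed

lemma homogeneous_inj:
  assumes "a \<in> G 0" "a' \<in> G 0" "b \<in> G 1" "b' \<in> G 1" "a + b = a' + b'"
  shows "a = a' \<and> b = b'"
proof -
  have "a - a' \<in> G 0" "b - b' \<in> G 1" using assms component_subspace subspace_diff by blast+
  moreover have "(a - a') + (b - b') = 0" using assms(5) by (simp add: algebra_simps)
  ultimately show ?thesis using homogeneous_eq_0 by fastforce
qed

lemma zero_in_component: "0 \<in> G g"
  using component_subspace subspace_0 by blast

lemma component_mult_simps: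
  "x \<in> G 0 \<Longrightarrow> y \<in> G 0 \<Longrightarrow> x * y \<in> G 0" "x \<in> G 0 \<Longrightarrow> y \<in> G 1 \<Longrightarrow> x * y \<in> G 1"
  "x \<in> G 1 \<Longrightarrow> y \<in> G 0 \<Longrightarrow> x * y \<in> G 1" "x \<in> G 1 \<Longrightarrow> y \<in> G 1 \<Longrightarrow> x * y \<in> G 0"
  using component_mult[of x 0 y 0] component_mult[of x 0 y 1]
    component_mult[of x 1 y 0] component_mult[of x 1 y 1] by simp_all

text \<open>Write \<open>1 = a + b\<close> with \<open>a\<close> even and \<open>b\<close> odd. The
  odd part of \<open>a = a * 1\<close> gives \<open>a * b = 0\<close>, and the even part of
  \<open>b = b * 1\<close> gives \<open>b * b = 0\<close>; so \<open>b = 1 * b = 0\<close>.\<close>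

lemma one_in_component: "1 \<in> G 0"
proof -
  obtain a b where ab: "a \<in> G 0" "b \<in> G 1" "1 = a + b" using homogeneous_decomposition by blast
  have "a + 0 = a * a + a * b" using ab(3) by (metis add_0_right distrib_left mult.right_neutral)
  then have "a * b = 0"
    using homogeneous_inj[of a "a * a" 0 "a * b"] ab zero_in_component component_mult_simps by metis
  moreover have "0 + b = b * b + b * a"
    using ab(3) by (metis add_0_left add.commute distrib_left mult.right_neutral)
  then have "b * b = 0"
    using homogeneous_inj[of 0 "b * b" b "b * a"] ab zero_in_component component_mult_simps by metis
  moreover have "b = a * b + b * b" using ab(3) by (metis distrib_right mult_1)
  ultimately show ?thesis using ab by simp
qed

lemma graded_subspaceI:
  assumes V: "subspace V" and ex: "\<And>x. x \<in> V \<Longrightarrow> \<exists>a\<in>V \<inter> G 0. \<exists>b\<in>V \<inter> G 1. x = a + b"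
  shows "graded_subspace V"
  unfolding graded_subspace_def
proof (intro conjI V internal_direct_sumI)
  show "x - y \<in> V \<inter> G i" if "x \<in> V \<inter> G i" "y \<in> V \<inter> G i" for i x y
    using that V component_subspace subspace_diff by blast
  fix x assume "x \<in> V"
  then obtain a b where ab: "a \<in> V \<inter> G 0" "b \<in> V \<inter> G 1" "x = a + b" using ex by blast
  then show "\<exists>v. (\<forall>i\<in>UNIV. v i \<in> V \<inter> G i) \<and> x = (\<Sum>i\<in>UNIV. v i)"
    by (intro exI[of _ "\<lambda>g. if g = 0 then a else b"]) (auto simp: UNIV_bit)
next
  fix v :: "bit \<Rightarrow> 'a" and i
  assume v: "\<And>i. i \<in> UNIV \<Longrightarrow> v i \<in> V \<inter> G i" and s: "(\<Sum>i\<in>UNIV. v i) = 0"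
  then have "v 0 = 0 \<and> v 1 = 0" by (intro homogeneous_eq_0) (auto simp: UNIV_bit)
  then show "v i = 0" using UNIV_bit by (metis UNIV_I empty_iff insert_iff)
qed simp

lemma graded_subspace_decomposition:
  assumes "graded_subspace V" "x \<in> V"
  shows "\<exists>a\<in>V \<inter> G 0. \<exists>b\<in>V \<inter> G 1. x = a + b"
proof -
  obtain v where "\<forall>i. v i \<in> V \<inter> G i" "x = (\<Sum>i\<in>UNIV. v i)"
    using assms unfolding graded_subspace_def internal_direct_sum_def by blast
  then show ?thesis by (intro bexI[of _ "v 0"] bexI[of _ "v 1"]) (auto simp: UNIV_bit)
qed

lemma line_graded_simple:
  assumes e: "e \<in> G 0" "e * e = e" "e \<noteq> 0"
  shows "graded_simple (range (\<lambda>k. scale k e))"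
proof -
  let ?W = "range (\<lambda>k. scale k e)"
  have W0: "?W \<subseteq> G 0" using e component_subspace subspace_scale by blast
  have sub: "subspace ?W"
    by (rule subspaceI) (auto simp: scale_left_distrib[symmetric] intro: range_eqI[of _ _ 0])
  have "graded_subspace ?W"
    by (rule graded_subspaceI[OF sub], rule bexI, rule bexI[of _ 0])
      (use W0 zero_in_component subspace_0[OF sub] in auto)
  then have "graded_subalgebra ?W"
    unfolding graded_subalgebra_def by (auto simp: scale_mult_left scale_mult_right e(2))
  moreover have "\<exists>x\<in>?W. \<exists>y\<in>?W. x * y \<noteq> 0"
    by (rule bexI[of _ e] bexI[of _ e])+ (auto simp: e intro: range_eqI[of _ _ 1])
  moreover have "I = {0} \<or> I = ?W" if I: "graded_ideal_of I ?W" for I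
  proof (rule disjCI)
    assume "I \<noteq> ?W"
    have sI: "subspace I" "I \<subseteq> ?W" using I unfolding graded_ideal_of_def graded_subspace_def by auto
    have "x = 0" if xI: "x \<in> I" for x
    proof (rule ccontr)
      assume "x \<noteq> 0"
      obtain k where k: "x = scale k e" using xI sI by blast
      with \<open>x \<noteq> 0\<close> have "k \<noteq> 0" by auto
      then have "scale l e = scale (l / k) x" for l using k by simp
      then have "?W \<subseteq> I" using sI(1) xI subspace_scale by auto
      then show False using \<open>I \<noteq> ?W\<close> sI by blast
    qed
    then show "I = {0}" using subspace_0[OF sI(1)] by blast
  qed
  ultimately show ?thesis unfolding graded_simple_def by blast
qed

lemma line_trivially_graded_field:
  assumes e: "e \<in> G 0" "e * e = e" "e \<noteq> 0"
  shows "trivially_graded_field (range (\<lambda>k. scale k e))"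
proof -
  have "alg_iso_base_field scale (range (\<lambda>k. scale k e))"
    unfolding alg_iso_base_field_def
    by (rule exI[of _ "\<lambda>k. scale k e"])
      (auto simp: bij_betw_def inj_on_def e scale_left_distrib scale_mult_left scale_mult_right)
  then show ?thesis
    unfolding trivially_graded_field_def using e component_subspace subspace_scale by blast
qed

section \<open>The algebra spanned by an even idempotent and an odd square root of it\<close>

definition plane :: "'a \<Rightarrow> 'a \<Rightarrow> 'a set" where
  "plane e c = {scale k e + scale l c | k l. True}"

context
  fixes e c
  assumes e: "e \<in> G 0" "e * e = e" "e \<noteq> 0" and c: "c \<in> G 1" "c * c = e" "e * c = c" "c * e = c"
begin

lemma planeI: "scale k e + scale l c \<in> plane e c"
  unfolding plane_def by blast

lemma plane_basis: "scale k e \<in> plane e c" "scale l c \<in> plane e c" "e \<in> plane e c" "c \<in> plane e c"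
  using planeI[of k 0] planeI[of 0 l] planeI[of 1 0] planeI[of 0 1] by simp_all

lemma scale_homogeneous: "scale k e \<in> G 0" "scale l c \<in> G 1"
  using e c component_subspace subspace_scale by blast+

lemma plane_component_0: "plane e c \<inter> G 0 = range (\<lambda>k. scale k e)"
proof (intro subset_antisym subsetI)
  fix x assume "x \<in> plane e c \<inter> G 0"
  then obtain k l where x: "x = scale k e + scale l c" "x \<in> G 0" unfolding plane_def by blast
  then have "x + 0 = scale k e + scale l c" by simp
  then have "x = scale k e"
    using homogeneous_inj[of x "scale k e" 0 "scale l c"] x scale_homogeneous zero_in_component by blast
  then show "x \<in> range (\<lambda>k. scale k e)" by blast
qed (use scale_homogeneous plane_basis in auto)

lemma plane_component_1: "plane e c \<inter> G 1 = range (\<lambda>k. scale k c)"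
proof (intro subset_antisym subsetI)
  fix x assume "x \<in> plane e c \<inter> G 1"
  then obtain k l where x: "x = scale k e + scale l c" "x \<in> G 1" unfolding plane_def by blast
  then have "0 + x = scale k e + scale l c" by simp
  then have "x = scale l c"
    using homogeneous_inj[of 0 "scale k e" x "scale l c"] x scale_homogeneous zero_in_component by blast
  then show "x \<in> range (\<lambda>k. scale k c)" by blast
qed (use scale_homogeneous plane_basis in auto)

lemma plane_subspace: "subspace (plane e c)"
proof (rule subspaceI)
  show "0 \<in> plane e c" using planeI[of 0 0] by simp
  fix x y k assume "x \<in> plane e c"
  then obtain a b where x: "x = scale a e + scale b c" unfolding plane_def by blast
  show "scale k x \<in> plane e c" using planeI[of "k * a" "k * b"] by (simp add: x scale_right_distrib)
  assume "y \<in> plane e c"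
  then obtain a' b' where y: "y = scale a' e + scale b' c" unfolding plane_def by blast
  show "x + y \<in> plane e c"
    using planeI[of "a + a'" "b + b'"] by (simp add: x y scale_left_distrib algebra_simps)
qed

lemma plane_mult: "x \<in> plane e c \<Longrightarrow> y \<in> plane e c \<Longrightarrow> x * y \<in> plane e c"
proof -
  assume "x \<in> plane e c" "y \<in> plane e c"
  then obtain a b a' b' where "x = scale a e + scale b c" "y = scale a' e + scale b' c"
    unfolding plane_def by blast
  then have "x * y = scale (a * a' + b * b') e + scale (a * b' + b * a') c"
    by (simp add: distrib_left distrib_right scale_mult_left scale_mult_right e c scale_left_distrib scale_right_distrib
        mult.commute add_ac)
  then show ?thesis using planeI by simp
qed

lemma plane_graded_subalgebra: "graded_subalgebra (plane e c)"
proof -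
  have "graded_subspace (plane e c)"
  proof (rule graded_subspaceI[OF plane_subspace])
    fix x assume "x \<in> plane e c"
    then obtain a b where "x = scale a e + scale b c" unfolding plane_def by blast
    then show "\<exists>a\<in>plane e c \<inter> G 0. \<exists>b\<in>plane e c \<inter> G 1. x = a + b"
      using plane_basis scale_homogeneous by blast
  qed
  then show ?thesis unfolding graded_subalgebra_def using plane_mult by blast
qed

lemma plane_unit: "x \<in> plane e c \<Longrightarrow> e * x = x \<and> x * e = x"
  unfolding plane_def using e c
  by (auto simp: distrib_left distrib_right scale_mult_left scale_mult_right)

text \<open>A graded ideal contains the homogeneous parts of its elements, here multiples of
  \<open>e\<close> and of \<open>c\<close>. Multiplication by \<open>c\<close> turns a multiple of
  \<open>c\<close> into the same multiple of \<open>e\<close>, so a nonzero graded ideal contains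
  the unit \<open>e\<close>. Gradedness matters: \<open>e + c\<close> spans an ideal that is not
  graded.\<close>

lemma plane_graded_simple: "graded_simple (plane e c)"
proof -
  have "\<exists>x\<in>plane e c. \<exists>y\<in>plane e c. x * y \<noteq> 0" using plane_basis e by metis
  moreover have "I = {0} \<or> I = plane e c" if I: "graded_ideal_of I (plane e c)" for I
  proof (rule disjCI)
    assume ne: "I \<noteq> plane e c"
    have sI: "subspace I" "graded_subspace I" "I \<subseteq> plane e c"
      and mul: "\<And>w x. w \<in> plane e c \<Longrightarrow> x \<in> I \<Longrightarrow> w * x \<in> I"
      using I unfolding graded_ideal_of_def graded_subspace_def by auto
    have eI: "e \<notin> I"
    proof
      assume "e \<in> I"
      then have "w \<in> I" if "w \<in> plane e c" for w using mul[OF that] plane_unit[OF that] by metis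
      then show False using ne sI(3) by blast
    qed
    have k0: "k = 0" if "scale k e \<in> I" for k
    proof (rule ccontr)
      assume "k \<noteq> 0"
      then have "e = scale (inverse k) (scale k e)" by simp
      then show False using eI subspace_scale[OF sI(1) that] by metis
    qed
    have "x = 0" if xI: "x \<in> I" for x
    proof -
      obtain a b where ab: "a \<in> I" "b \<in> I" "a \<in> G 0" "b \<in> G 1" "x = a + b"
        using graded_subspace_decomposition[OF sI(2) xI] by blast
      then obtain k l where kl: "a = scale k e" "b = scale l c"
        using sI(3) plane_component_0 plane_component_1 by blast
      have "c * b = scale l e" using kl c by (simp add: scale_mult_right)
      then have "scale l e \<in> I" using mul[OF plane_basis(4) ab(2)] by simp
      then have "l = 0" "k = 0" using k0 ab(1) kl(1) by auto
      then show ?thesis using kl ab(5) by simp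
    qed
    then show "I = {0}" using subspace_0[OF sI(1)] by blast
  qed
  ultimately show ?thesis unfolding graded_simple_def using plane_graded_subalgebra by blast
qed

lemma plane_field_plus_odd_line: "field_plus_odd_line (plane e c) c"
proof -
  have "c \<noteq> 0" using c e by auto
  then show ?thesis unfolding field_plus_odd_line_def plane_component_0 plane_component_1
    using line_trivially_graded_field[OF e] plane_graded_subalgebra
    unfolding trivially_graded_field_def by blast
qed

lemma plane_unit_of: "unit_of (plane e c) (c * c)"
  unfolding unit_of_def c using plane_basis plane_unit by blast

end

end


section \<open>Splitting a commutative graded algebra along its even primitive idempotents\<close>

locale comm_graded_algebra = comm_fd_algebra scale + Z2_graded_algebra scale G
  for scale :: "'k::{alg_closed_field, field_char_0} \<Rightarrow> 'a::ring_1 \<Rightarrow> 'a"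
    and G :: "bit \<Rightarrow> 'a set"
begin

lemma even_subalgebra: "unital_subalgebra (G 0)"
  unfolding unital_subalgebra_def
  using component_subspace one_in_component component_mult_simps(1) by blast

text \<open>The automorphism \<open>a + b \<mapsto> a - b\<close> of the algebra preserves nilpotency.\<close>

lemma nilpotent_homogeneous_parts:
  assumes a: "a \<in> G 0" and b: "b \<in> G 1" and "nilpotent (a + b)"
  shows "nilpotent a \<and> nilpotent b"
proof -
  \<comment> \<open>The same \<open>u\<close> and \<open>v\<close> serve both powers; if
    \<open>(a + b) ^ n\<close> vanishes, then so do \<open>u\<close> and \<open>v\<close>, and with
    them \<open>(a - b) ^ n\<close>.\<close>
  have *: "\<exists>u\<in>G 0. \<exists>v\<in>G 1. (a + b) ^ n = u + v \<and> (a - b) ^ n = u - v" for n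
  proof (induction n)
    case 0
    show ?case
      by (rule bexI[OF _ one_in_component], rule bexI[OF _ zero_in_component]) simp
  next
    case (Suc n)
    then obtain u v where uv: "u \<in> G 0" "v \<in> G 1" "(a + b) ^ n = u + v" "(a - b) ^ n = u - v"
      by blast
    have "a * u + b * v \<in> G 0" "a * v + b * u \<in> G 1"
      by (intro subspace_add component_subspace component_mult_simps uv a b)+
    moreover have "(a + b) ^ Suc n = (a * u + b * v) + (a * v + b * u)"
      "(a - b) ^ Suc n = (a * u + b * v) - (a * v + b * u)"
      unfolding power_Suc uv by (simp_all add: algebra_simps)
    ultimately show ?case by blast
  qed
  obtain n where "(a + b) ^ n = 0" using assms(3) unfolding nilpotent_def by blast
  then obtain u v where "u \<in> G 0" "v \<in> G 1" "u + v = 0" "(a - b) ^ n = u - v" using *[of n] by metis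
  then have "(a - b) ^ n = 0" using homogeneous_eq_0 by force
  then have m: "nilpotent (a - b)" unfolding nilpotent_def by blast
  \<comment> \<open>As the characteristic is not 2, \<open>a\<close> and \<open>b\<close> are
    recovered from \<open>a + b\<close> and \<open>a - b\<close>.\<close>
  have half: "scale (1/2) (x + x) = x" for x :: 'a
    by (simp add: scale_right_distrib scale_left_distrib[symmetric])
  have "nilpotent (scale (1/2) ((a + b) + (a - b)))" "nilpotent (scale (1/2) ((a + b) - (a - b)))"
    by (intro nilpotent_scale nilpotent_add nilpotent_diff assms(3) m)+
  moreover have "(a + b) + (a - b) = a + a" "(a + b) - (a - b) = b + b" by simp_all
  ultimately show ?thesis by (simp add: half)
qed

lemma radical_graded_subspace: "graded_subspace jacobson_radical"
proof (rule graded_subspaceI)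
  show "subspace jacobson_radical"
    by (rule subspaceI) (auto simp: jacobson_radical_eq intro: nilpotent_add nilpotent_scale)
  fix x :: 'a assume "x \<in> jacobson_radical"
  moreover obtain a b where "a \<in> G 0" "b \<in> G 1" "x = a + b" using homogeneous_decomposition by blast
  ultimately show "\<exists>a\<in>jacobson_radical \<inter> G 0. \<exists>b\<in>jacobson_radical \<inter> G 1. x = a + b"
    using nilpotent_homogeneous_parts[of a b] unfolding jacobson_radical_eq by blast
qed

text \<open>The square of \<open>y = e * x\<close> is even, so it is \<open>l e\<close> plus a
  nilpotent element, and \<open>l\<close> is nonzero because \<open>y\<close> is not nilpotent.
  Dividing \<open>y\<close> by a square root of \<open>l\<close> gives \<open>d\<close> with
  \<open>d * d = e + z\<close> and \<open>z\<close> nilpotent; Newton's iteration removes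
  \<open>z\<close> at the cost of an even factor \<open>u\<close>, which keeps \<open>u * d\<close>
  odd.\<close>

lemma odd_square_root:
  assumes e: "primitive_idempotent (G 0) e" and x: "x \<in> G 1" and "\<not> nilpotent (e * x)"
  shows "\<exists>c\<in>G 1. c * c = e \<and> e * c = c"
proof -
  have ee: "e \<in> G 0" "e * e = e" using e unfolding primitive_idempotent_def by auto
  define y where "y = e * x"
  have ey: "e * y = y" unfolding y_def using ee(2) by (metis mult.assoc)
  then have y: "y \<in> G 1" "e * y = y" "y * e = y" "\<not> nilpotent y"
    using component_mult_simps(2)[OF ee(1) x] assms(3) comm[of y e] unfolding y_def by simp_all
  have yy: "y * y \<in> G 0" using y component_mult_simps(4) by blast
  obtain l where l: "nilpotent (y * y * e - scale l e)"
    using primitive_eigenvalue[OF even_subalgebra e yy] by blast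
  have yye: "y * y * e = y * y" using y by (simp add: mult.assoc)
  have "l \<noteq> 0"
  proof
    assume "l = 0"
    then obtain n where "(y * y) ^ n = 0" using l yye unfolding nilpotent_def by auto
    then have "y ^ (n + n) = 0" by (simp add: power_mult_eq power_add)
    then show False using y(4) unfolding nilpotent_def by blast
  qed
  obtain s where s: "s ^ 2 = l" using nth_root_exists[of 2 l] by auto
  with \<open>l \<noteq> 0\<close> have s0: "s \<noteq> 0" by auto
  define d where "d = scale (1 / s) y"
  define z where "z = scale (1 / l) (y * y - scale l e)"
  have "d * d = scale (1 / l) (y * y)"
    unfolding d_def by (simp add: scale_mult_left scale_mult_right s[symmetric] power2_eq_square)
  then have "d * d = e + z" unfolding z_def using \<open>l \<noteq> 0\<close> by (simp add: scale_right_diff_distrib)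
  moreover have "nilpotent z" unfolding z_def using l yye nilpotent_scale by simp
  moreover have "z \<in> G 0"
    unfolding z_def using yy ee by (intro subspace_scale subspace_diff component_subspace)
  moreover have "e * d = d" unfolding d_def using y by (simp add: scale_mult_right)
  ultimately obtain u where u: "u \<in> G 0" "(u * d) * (u * d) = e"
    using sqrt_idempotent[OF even_subalgebra ee(1) _ ee(2), of z d] by blast
  have "d \<in> G 1" unfolding d_def using y component_subspace subspace_scale by blast
  then have "u * d \<in> G 1" using u component_mult_simps(2) by blast
  moreover have "e * (u * d) = u * d" using \<open>e * d = d\<close> left_comm[of e u d] by simp
  ultimately show ?thesis using u(2) by blast
qed

lemma local_component_decomposition:
  assumes "primitive_idempotent (G 0) e" and "x \<in> G 0"
  shows "\<exists>k. nilpotent (e * x - scale k e)"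
  using primitive_eigenvalue[OF even_subalgebra assms] by (simp add: comm[of e x])

text \<open>The even part of \<open>x\<close> is a multiple of \<open>e\<close> up to nilpotents.
  For the odd part \<open>b\<close> the same holds of the even element \<open>c * b\<close>, and a
  second multiplication by \<open>c\<close> leads back to \<open>e * b\<close>, now as a multiple of
  \<open>c\<close>.\<close>

lemma local_plane_decomposition:
  assumes e: "primitive_idempotent (G 0) e" and c: "c \<in> G 1" "c * c = e" "e * c = c"
  shows "\<exists>w\<in>plane e c. nilpotent (e * x - w)"
proof -
  obtain a b where ab: "a \<in> G 0" "b \<in> G 1" "x = a + b" using homogeneous_decomposition by blast
  obtain k where k: "nilpotent (e * a - scale k e)"
    using local_component_decomposition[OF e ab(1)] by blast
  have "c * b \<in> G 0" using c ab component_mult_simps by blast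
  then obtain l where l: "nilpotent (e * (c * b) - scale l e)"
    using local_component_decomposition[OF e] by blast
  have "c * (e * (c * b)) = e * b" using left_comm[of c e "c * b"] c(2,3) by (simp add: mult.assoc[symmetric])
  moreover have "c * scale l e = scale l c" using c(3) comm[of c e] by (simp add: scale_mult_right)
  ultimately have "nilpotent (e * b - scale l c)"
    using nilpotent_mult_left[OF l, of c] by (simp add: right_diff_distrib)
  from nilpotent_add[OF k this] have "nilpotent (e * x - (scale k e + scale l c))"
    by (simp add: ab(3) algebra_simps)
  then show ?thesis unfolding plane_def by blast
qed

text \<open>Both homogeneous parts are nilpotent, and \<open>c\<close> carries the odd one to a
  multiple of \<open>e\<close>; a nonzero multiple of a nonzero idempotent is not nilpotent.\<close>

lemma plane_nilpotent:
  assumes e: "e \<in> G 0" "e * e = e" "e \<noteq> 0" and c: "c \<in> G 1" "c * c = e"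
    and x: "x \<in> plane e c" "nilpotent x"
  shows "x = 0"
proof -
  obtain k l where kl: "x = scale k e + scale l c" using x(1) unfolding plane_def by blast
  have "scale k e \<in> G 0" "scale l c \<in> G 1" using e c component_subspace subspace_scale by blast+
  then have n: "nilpotent (scale k e)" "nilpotent (scale l c)"
    using nilpotent_homogeneous_parts x(2) kl by blast+
  have "nilpotent (scale l e)"
    using nilpotent_mult[OF n(2), of c] c by (simp add: scale_mult_left)
  then have "l = 0" "k = 0" using n(1) nilpotent_scale_idempotent[OF e(2,3)] by blast+
  then show ?thesis using kl by simp
qed

lemma graded_wedderburn_malcev_exists:
  assumes odd: "\<exists>x\<in>G 1. \<not> nilpotent x"
  shows "\<exists>(r::nat) (p::nat) (W :: nat \<Rightarrow> 'a set) (c :: nat \<Rightarrow> 'a).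
      p \<ge> 1 \<and> graded_wedderburn_malcev (r + p) W \<and>
      (\<forall>i<r. trivially_graded_field (W i)) \<and>
      (\<forall>i\<in>{r..<r + p}. field_plus_odd_line (W i) (c i) \<and> unit_of (W i) (c i * c i))"
proof -
  obtain F where F: "finite F" "\<forall>e\<in>F. primitive_idempotent (G 0) e"
      "\<forall>e\<in>F. \<forall>f\<in>F. e \<noteq> f \<longrightarrow> e * f = 0" "\<Sum>F = 1"
    using primitive_decomposition[OF even_subalgebra] by (elim exE conjE) (rule that)
  \<comment> \<open>These idempotents yield the summands \<open>K\<close>; each of the others has an
    odd square root and yields a summand \<open>K + c K\<close>.\<close>
  define F1 where "F1 = {e \<in> F. \<forall>x\<in>G 1. nilpotent (e * x)}"
  obtain xs where xs: "set xs = F1" "distinct xs"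
    using finite_distinct_list[of F1] F(1) unfolding F1_def by auto
  obtain ys where ys: "set ys = F - F1" "distinct ys"
    using finite_distinct_list[of "F - F1"] F(1) by auto
  define r where "r = length xs"
  define p where "p = length ys"
  \<comment> \<open>Listing the members of \<open>F1\<close> first makes the index \<open>r\<close>
    the boundary between the two kinds of summands.\<close>
  define e where "e i = (xs @ ys) ! i" for i
  have setF: "set (xs @ ys) = F" using xs ys unfolding F1_def by auto
  have bij: "bij_betw e {..<r + p} F"
  proof -
    have "distinct (xs @ ys)" using xs ys by auto
    then have "bij_betw ((!) (xs @ ys)) {..<r + p} F"
      by (rule bij_betw_nth) (simp_all only: length_append r_def p_def setF)
    moreover have "e = (!) (xs @ ys)" by (rule ext) (rule e_def)
    ultimately show ?thesis by (simp only:)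
  qed
  have eF: "e i \<in> F" if "i < r + p" for i using bij_betwE[OF bij] that by simp
  have e1: "e i \<in> F1" if "i < r" for i
    using that nth_mem[of i xs] xs unfolding e_def r_def by (simp add: nth_append)
  have e2: "e i \<in> F - F1" if "r \<le> i" "i < r + p" for i
    using that nth_mem[of "i - r" ys] ys unfolding e_def r_def p_def by (simp add: nth_append)
  have prim: "primitive_idempotent (G 0) (e i)" if "i < r + p" for i using bspec[OF F(2) eF[OF that]] .
  have idem: "e i \<in> G 0" "e i * e i = e i" "e i \<noteq> 0" if "i < r + p" for i
    using prim[OF that] unfolding primitive_idempotent_def by simp_all
  have orth: "e i * e j = 0" if "i < r + p" "j < r + p" "i \<noteq> j" for i j
  proof -
    have "e i \<noteq> e j" using inj_onD[OF bij_betw_imp_inj_on[OF bij], of i j] that by auto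
    then show ?thesis using bspec[OF bspec[OF F(3) eF[OF that(1)]] eF[OF that(2)]] by simp
  qed
  have sum1: "(\<Sum>i<r + p. e i) = 1"
    using sum.reindex_bij_betw[OF bij, of "\<lambda>x. x"] F(4) by simp
  have "\<forall>f\<in>F - F1. \<exists>c. c \<in> G 1 \<and> c * c = f \<and> f * c = c"
  proof
    fix f assume f: "f \<in> F - F1"
    then obtain x where "x \<in> G 1" "\<not> nilpotent (f * x)" unfolding F1_def by blast
    then show "\<exists>c. c \<in> G 1 \<and> c * c = f \<and> f * c = c"
      using odd_square_root[of f x] F(2) f by blast
  qed
  from bchoice[OF this] obtain s
    where s: "\<forall>f\<in>F - F1. s f \<in> G 1 \<and> s f * s f = f \<and> f * s f = s f" by blast
  define c where "c i = s (e i)" for i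
  have c: "c i \<in> G 1" "c i * c i = e i" "e i * c i = c i" "c i * e i = c i"
    if "r \<le> i" "i < r + p" for i
    using bspec[OF s e2[OF that]] comm[of "c i" "e i"] unfolding c_def by simp_all
  define W where "W i = (if i < r then range (\<lambda>k. scale k (e i)) else plane (e i) (c i))" for i
  have subW: "subspace (W i)" if "i < r + p" for i
  proof (cases "i < r")
    case True
    then show ?thesis using line_graded_simple[of "e i"] idem[OF that]
      unfolding W_def graded_simple_def graded_subalgebra_def graded_subspace_def by simp
  next
    case False
    then show ?thesis using plane_subspace[OF idem[OF that] c[of i]] that unfolding W_def by simp
  qed
  have unit: "e i * x = x" if "x \<in> W i" "i < r + p" for i x
  proof (cases "i < r")
    case True
    then show ?thesis using that idem[of i] unfolding W_def by (auto simp: scale_mult_right)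
  next
    case False
    then show ?thesis using plane_unit[OF idem[OF that(2)] c[of i]] that unfolding W_def by simp
  qed
  have kill: "e j * x = 0" if "x \<in> W i" "i < r + p" "j < r + p" "i \<noteq> j" for i j x
  proof -
    have "e j * x = (e j * e i) * x" using unit[OF that(1,2)] by (simp add: mult.assoc)
    then show ?thesis using orth[of j i] that by simp
  qed
  have part: "\<exists>w\<in>W i. nilpotent (e i * x - w)" if i: "i < r + p" for i x
  proof (cases "i < r")
    case True
    obtain a b where ab: "a \<in> G 0" "b \<in> G 1" "x = a + b" using homogeneous_decomposition by blast
    obtain k where k: "nilpotent (e i * a - scale k (e i))"
      using local_component_decomposition[OF prim[OF i] ab(1)] by blast
    have "nilpotent (e i * b)" using e1[OF True] ab(2) unfolding F1_def by blast
    from nilpotent_add[OF k this] have "nilpotent (e i * x - scale k (e i))"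
      by (simp add: ab(3) algebra_simps)
    then show ?thesis using True unfolding W_def by auto
  next
    case False
    then show ?thesis
      using local_plane_decomposition[OF prim[OF i] c(1-3)[of i], of x] i unfolding W_def by simp
  qed
  have semi: "x = 0" if "x \<in> W i" "nilpotent x" "i < r + p" for i x
  proof (cases "i < r")
    case True
    then show ?thesis
      using that nilpotent_scale_idempotent[OF idem(2,3)[OF that(3)]] unfolding W_def by auto
  next
    case False
    then show ?thesis
      using plane_nilpotent[OF idem[OF that(3)] c(1,2)[of i], of x] that unfolding W_def by simp
  qed
  let ?V = "\<lambda>i. if i < r + p then W i else jacobson_radical"
  have direct: "internal_direct_sum {..r + p} ?V UNIV"
  proof (rule internal_direct_sumI)
    fix i x y assume "x \<in> ?V i" "y \<in> ?V i"
    then show "x - y \<in> ?V i"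
      using subW[of i] radical_graded_subspace unfolding graded_subspace_def
      by (auto intro: subspace_diff)
  next
    fix x :: 'a
    have "\<forall>i\<in>{..<r + p}. \<exists>w. w \<in> W i \<and> nilpotent (e i * x - w)" using part by blast
    from bchoice[OF this] obtain w
      where w: "\<And>i. i < r + p \<Longrightarrow> w i \<in> W i \<and> nilpotent (e i * x - w i)" by blast
    \<comment> \<open>The radical part of \<open>x\<close> collects the nilpotent errors from all
      blocks.\<close>
    define n where "n = (\<Sum>i<r + p. e i * x - w i)"
    have "nilpotent n" unfolding n_def using w by (intro nilpotent_sum) auto
    have "x = (\<Sum>i<r + p. e i * x)" by (simp add: sum_distrib_right[symmetric] sum1)
    then have "x = (\<Sum>i<r + p. w i) + n" unfolding n_def by (simp add: sum_subtractf)
    then show "\<exists>v. (\<forall>i\<in>{..r + p}. v i \<in> ?V i) \<and> x = (\<Sum>i\<in>{..r + p}. v i)"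
      using w \<open>nilpotent n\<close>
      by (intro exI[of _ "\<lambda>i. if i < r + p then w i else n"]) (auto simp: lessThan_Suc_atMost[symmetric] jacobson_radical_eq)
  next
    fix v i
    assume v: "\<And>i. i \<in> {..r + p} \<Longrightarrow> v i \<in> ?V i" and s0: "(\<Sum>i\<in>{..r + p}. v i) = 0"
      and i: "i \<in> {..r + p}"
    have vW: "v i \<in> W i" if "i < r + p" for i using v[of i] that by simp
    have vn: "nilpotent (v (r + p))" using v[of "r + p"] by (simp add: jacobson_radical_eq)
    have s1: "(\<Sum>i<r + p. v i) + v (r + p) = 0"
      using s0 by (simp add: lessThan_Suc_atMost[symmetric])
    \<comment> \<open>Multiplication by \<open>e j\<close> isolates \<open>v j\<close> and gives
      \<open>v j = - (e j * v (r + p))\<close>. This is nilpotent, and \<open>W j\<close> has no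
      nonzero nilpotent elements.\<close>
    have z: "v j = 0" if j: "j < r + p" for j
    proof -
      have "e j * (\<Sum>i<r + p. v i) = (\<Sum>i<r + p. if i = j then v j else 0)"
        unfolding sum_distrib_left
      proof (rule sum.cong)
        fix i assume i: "i \<in> {..<r + p}"
        then show "e j * v i = (if i = j then v j else 0)"
          using unit[OF vW[OF j] j] kill[OF vW[of i] _ j] by auto
      qed simp
      then have "e j * (\<Sum>i<r + p. v i) = v j" using j by simp
      then have "v j + e j * v (r + p) = 0"
        using arg_cong[OF s1, of "(*) (e j)"] by (simp add: distrib_left)
      then have "v j = - (e j * v (r + p))" by (simp add: eq_neg_iff_add_eq_0)
      then have "nilpotent (v j)" using nilpotent_uminus[OF nilpotent_mult_left[OF vn]] by simp
      then show ?thesis using semi[OF vW[OF j] _ j] by simp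
    qed
    then have "v (r + p) = 0" using s1 by simp
    then show "v i = 0" using z i by (cases "i = r + p") auto
  qed simp
  have "graded_simple (W i)" if "i < r + p" for i
    using line_graded_simple[OF idem[OF that]] plane_graded_simple[OF idem[OF that] c[of i]] that
    unfolding W_def by simp
  moreover have "x * y = 0" if "i < r + p" "j < r + p" "i \<noteq> j" "x \<in> W i" "y \<in> W j" for i j x y
  proof -
    have "x * y = x * (e i * y)" using unit[OF that(4,1)] left_comm[of x "e i" y] by (simp add: mult.assoc[symmetric])
    then show ?thesis using kill[OF that(5,2,1)] that(3) by simp
  qed
  ultimately have "graded_wedderburn_malcev (r + p) W"
    unfolding graded_wedderburn_malcev_def using radical_graded_subspace direct by blast
  moreover have "trivially_graded_field (W i)" if "i < r" for i
    using line_trivially_graded_field[of "e i"] idem[of i] that unfolding W_def by simp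
  moreover have "field_plus_odd_line (W i) (c i) \<and> unit_of (W i) (c i * c i)"
    if "i \<in> {r..<r + p}" for i
  proof -
    have i: "r \<le> i" "i < r + p" using that by auto
    show ?thesis
      using plane_field_plus_odd_line[OF idem[OF i(2)] c[OF i]] plane_unit_of[OF idem[OF i(2)] c[OF i]] i
      unfolding W_def by simp
  qed
  \<comment> \<open>If every idempotent were in \<open>F1\<close>, any odd \<open>x\<close> would be
    the sum of the nilpotent elements \<open>f * x\<close>, contrary to \<open>odd\<close>.\<close>
  moreover have "p \<ge> 1"
  proof (rule ccontr)
    assume "\<not> p \<ge> 1"
    then have "ys = []" unfolding p_def by (simp add: not_le)
    then have "F - F1 = {}" using ys(1) by simp
    then have "F = F1" unfolding F1_def by blast
    obtain x where x: "x \<in> G 1" "\<not> nilpotent x" using odd by blast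
    have "nilpotent (\<Sum>f\<in>F. f * x)"
      using \<open>F = F1\<close> x(1) unfolding F1_def by (intro nilpotent_sum) blast
    moreover have "(\<Sum>f\<in>F. f * x) = x" by (simp add: sum_distrib_right[symmetric] F(4))
    ultimately show False using x(2) by simp
  qed
  ultimately show ?thesis by blast
qed

end


section \<open>Identities of regular algebras and of Grassmann envelopes\<close>

lemma eval_single:
  assumes "assoc_algebra scale"
  shows "eval_poly scale \<phi> (Poly_Mapping.single w 1) = prod_list (map \<phi> w)"
proof -
  interpret assoc_algebra scale by fact
  show ?thesis by (simp add: eval_poly_def)
qed

text \<open>The indices \<open>0\<close> and \<open>1\<close> keep the two variables distinct when
  \<open>g = h\<close>.\<close>

definition commutation_poly :: "bit \<Rightarrow> bit \<Rightarrow> 'k::field \<Rightarrow> 'k graded_poly" where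
  "commutation_poly g h b =
     Poly_Mapping.single [(g, 0), (h, 1)] 1 - Poly_Mapping.single [(h, 1), (g, 0)] b"

lemma eval_commutation_poly:
  assumes "assoc_algebra scale" and "b \<noteq> 0"
  shows "eval_poly scale \<phi> (commutation_poly g h b) =
    \<phi> (g, 0) * \<phi> (h, 1) - scale b (\<phi> (h, 1) * \<phi> (g, 0))"
proof -
  interpret assoc_algebra scale by fact
  let ?w1 = "[(g, 0), (h, 1)] :: (bit \<times> nat) list" and ?w2 = "[(h, 1), (g, 0)] :: (bit \<times> nat) list"
  have ne: "?w1 \<noteq> ?w2" by simp
  have lk: "Poly_Mapping.lookup (commutation_poly g h b) w =
      (if w = ?w1 then 1 else if w = ?w2 then - b else 0)" for w
    using ne by (auto simp: commutation_poly_def lookup_minus lookup_single)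
  have "Poly_Mapping.keys (commutation_poly g h b) = {?w1, ?w2}"
    using assms(2) by (auto simp: in_keys_iff lk split: if_splits)
  then show ?thesis unfolding eval_poly_def using ne by (simp add: lk)
qed

text \<open>The unit is even and commutes with everything, which settles all factors except
  \<open>\<beta> 1 1\<close>. Exchanging two odd elements twice, with nonzero product, gives
  \<open>\<beta> 1 1 = 1\<close> or \<open>\<beta> 1 1 = - 1\<close>; the value \<open>1\<close>
  would make the columns of \<open>0\<close> and \<open>1\<close> equal, against minimality.\<close>

lemma minimal_regular_commutation_factors:
  assumes "Z2_graded_algebra scale G" and reg: "regular_grading scale G \<beta>"
    and min: "minimal_decomposition \<beta>"
  shows "\<beta> 0 0 = 1" "\<beta> 0 1 = 1" "\<beta> 1 0 = 1" "\<beta> 1 1 = - 1"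
proof -
  interpret Z2_graded_algebra scale G by fact
  have comm: "a * b = scale (\<beta> g h) (b * a)" if "a \<in> G g" "b \<in> G h" for a b g h
    using reg that unfolding regular_grading_def by blast
  have nz: "\<exists>as. list_all2 (\<lambda>a g. a \<in> G g) as gs \<and> prod_list as \<noteq> 0" for gs
    using reg unfolding regular_grading_def by blast
  have one: "k = 1" if "x = scale k x" "x \<noteq> 0" for k and x :: 'b
    using that scale_right_imp_eq[of x 1 k] by simp
  obtain x where x: "x \<in> G 1" "x \<noteq> 0"
    using nz[of "[1]"] by (auto simp: list_all2_Cons2)
  obtain y z where yz: "y \<in> G 1" "z \<in> G 1" "y * z \<noteq> 0"
    using nz[of "[1, 1]"] by (auto simp: list_all2_Cons2)
  show b00: "\<beta> 0 0 = 1" using comm[OF one_in_component one_in_component] one[of 1] by simp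
  show b01: "\<beta> 0 1 = 1" using comm[OF one_in_component x(1)] one[of x] x(2) by simp
  show b10: "\<beta> 1 0 = 1" using comm[OF x(1) one_in_component] one[of x] x(2) by simp
  have "y * z = scale (\<beta> 1 1 * \<beta> 1 1) (y * z)"
    using comm[OF yz(1,2)] comm[OF yz(2,1)] by simp
  then have "\<beta> 1 1 * \<beta> 1 1 = 1" using one yz(3) by blast
  then have "\<beta> 1 1 = 1 \<or> \<beta> 1 1 = - 1" by (simp add: square_eq_1_iff)
  moreover have "\<beta> 1 1 \<noteq> 1"
  proof
    assume "\<beta> 1 1 = 1"
    then have "\<beta> g 0 = \<beta> g 1" for g
      using b00 b01 b10 UNIV_bit by (metis UNIV_I empty_iff insert_iff)
    then show False using min unfolding minimal_decomposition_def by (metis zero_neq_one)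
  qed
  ultimately show "\<beta> 1 1 = - 1" by blast
qed

text \<open>A simple Grassmann element of degree \<open>g\<close>, used to lift an element of
  \<open>C g\<close> into the envelope.\<close>

definition grassmann_letter :: "bit \<Rightarrow> nat \<Rightarrow> 'k::field grassmann" where
  "grassmann_letter g i = (if g = 0 then 1 else gen i)"

lemma assoc_algebra_times: "assoc_algebra ((*) :: 'k::field \<Rightarrow> 'k \<Rightarrow> 'k)"
  by unfold_locales (simp_all add: algebra_simps)

lemma grassmann_letter_component: "(grassmann_letter g i :: 'k::field grassmann) \<in> grassmann_component g"
proof -
  interpret assoc_algebra "gscale ((*) :: 'k \<Rightarrow> 'k \<Rightarrow> 'k)"
    by (rule assoc_algebra_gscale[OF assoc_algebra_times])
  have "\<exists>js. grassmann_letter g i = (prod_list (map gen js) :: 'k grassmann) \<and> of_nat (length js) = g"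
    by (rule exI[of _ "if g = 0 then [] else [i]"]) (simp add: grassmann_letter_def)
  then show ?thesis unfolding grassmann_component_def by (intro span_base) blast
qed

lemma pure_tensor_in_envelope:
  assumes "assoc_algebra scale" and "a \<in> G g"
  shows "pure_tensor scale a (grassmann_letter g i) \<in> grassmann_envelope scale G g"
proof -
  interpret assoc_algebra "gscale scale" by (rule assoc_algebra_gscale[OF assms(1)])
  show ?thesis unfolding grassmann_envelope_def
    using assms(2) grassmann_letter_component by (intro span_base) blast
qed

lemma zero_in_envelope:
  assumes "assoc_algebra scale"
  shows "0 \<in> grassmann_envelope scale G g"
proof -
  interpret assoc_algebra "gscale scale" by (rule assoc_algebra_gscale[OF assms])
  show ?thesis unfolding grassmann_envelope_def by (rule span_zero)
qed

text \<open>Two odd letters anticommute and all other pairs commute, so exchanging them produces the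
  factor \<open>b\<close>. The distinct indices \<open>0\<close> and \<open>1\<close> keep the
  product of two odd letters nonzero, and \<open>S\<close> is a basis monomial at which this is
  visible.\<close>

lemma grassmann_letter_commute:
  fixes b :: "'k::field"
  assumes "b = (if g = 1 \<and> h = 1 then - 1 else 1)"
  shows "\<exists>S s. s \<noteq> 0 \<and> gcoeff (grassmann_letter g 0 * grassmann_letter h 1 :: 'k grassmann) S = s \<and>
    b * gcoeff (grassmann_letter h 1 * grassmann_letter g 0) S = s"
proof -
  have g1: "gcoeff (prod_list (map gen js) :: 'k grassmann) (set js) = 1" if "sorted_wrt (<) js" for js
    by (simp add: gcoeff_increasing_monomial that)
  have "g = 0 \<or> g = 1" "h = 0 \<or> h = 1" using UNIV_bit by auto
  then consider "g = 0" "h = 0" | "g = 0" "h = 1" | "g = 1" "h = 0" | "g = 1" "h = 1" by blast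
  then show ?thesis
  proof cases
    case 1
    then show ?thesis using g1[of "[]"] assms
      by (intro exI[of _ "{}"] exI[of _ 1]) (simp add: grassmann_letter_def)
  next
    case 2
    then show ?thesis using g1[of "[1]"] assms
      by (intro exI[of _ "{1}"] exI[of _ 1]) (simp add: grassmann_letter_def)
  next
    case 3
    then show ?thesis using g1[of "[0]"] assms
      by (intro exI[of _ "{0}"] exI[of _ 1]) (simp add: grassmann_letter_def)
  next
    case 4
    then show ?thesis using g1[of "[0, 1]"] assms gen_anticommute[of 1 0, where 'k='k]
      by (intro exI[of _ "{0, 1}"] exI[of _ 1]) (simp add: grassmann_letter_def uminus_grassmann.rep_eq)
  qed
qed

text \<open>Evaluate the identity at the tensors of \<open>x\<close> and \<open>y\<close> with
  letters. At the monomial \<open>S\<close> the sign from the letters cancels \<open>b\<close>, and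
  \<open>x * y = y * x\<close> remains.\<close>

lemma envelope_supercommutative_imp_commute:
  fixes scale :: "'k::field \<Rightarrow> 'c::ring_1 \<Rightarrow> 'c" and b :: 'k
  assumes alg: "assoc_algebra scale" and b: "b = (if g = 1 \<and> h = 1 then - 1 else 1)"
    and id: "commutation_poly g h b \<in> T_Z2 (gscale scale) (grassmann_envelope scale G)"
    and x: "x \<in> G g" and y: "y \<in> G h"
  shows "x * y = y * x"
proof -
  interpret assoc_algebra scale by fact
  have b0: "b \<noteq> 0" using b by auto
  define X where "X = pure_tensor scale x (grassmann_letter g 0)"
  define Y where "Y = pure_tensor scale y (grassmann_letter h 1)"
  define \<phi> where "\<phi> p = (if p = (g, 0) then X else if p = (h, 1) then Y else 0)" for p :: "bit \<times> nat"
  have "\<phi> (g', i) \<in> grassmann_envelope scale G g'" for g' i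
    using pure_tensor_in_envelope[OF alg, of x G g] pure_tensor_in_envelope[OF alg, of y G h]
      zero_in_envelope[OF alg] x y unfolding \<phi>_def X_def Y_def by auto
  then have "eval_poly (gscale scale) \<phi> (commutation_poly g h b) = 0"
    using id unfolding T_Z2_def by blast
  then have XY: "X * Y = gscale scale b (Y * X)"
    using eval_commutation_poly[OF assoc_algebra_gscale[OF alg] b0, of \<phi> g h]
    by (simp add: \<phi>_def)
  obtain S s where s: "s \<noteq> 0"
    "gcoeff (grassmann_letter g 0 * grassmann_letter h 1 :: 'k grassmann) S = s"
    "b * gcoeff (grassmann_letter h 1 * grassmann_letter g 0) S = s"
    using grassmann_letter_commute[OF b] by blast
  have "scale s (x * y) = scale s (y * x)"
    using arg_cong[OF XY, of "\<lambda>z. gcoeff z S"] s(2,3) unfolding X_def Y_def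
    by (simp add: pure_tensor_mult[OF alg] gcoeff_pure_tensor[OF vector_space_axioms])
  then show ?thesis using s(1) by simp
qed

section \<open>Nonzero products in the envelope and in the algebra\<close>

lemma gcoeff_envelope:
  assumes G: "Z2_graded_algebra scale G" and x: "x \<in> grassmann_envelope scale G g"
  shows "gcoeff x S \<in> G g"
proof -
  interpret Z2_graded_algebra scale G by fact
  interpret env: assoc_algebra "gscale scale" by (rule assoc_algebra_gscale) unfold_locales
  note sub = component_subspace[of g]
  show ?thesis using x unfolding grassmann_envelope_def
  proof (induction rule: env.span_induct_alt)
    case base
    then show ?case using subspace_0[OF sub] by (simp add: zero_grassmann.rep_eq)
  next
    case (step k x y)
    then have "gcoeff x S \<in> G g"
      using subspace_scale[OF sub] by (auto simp: gcoeff_pure_tensor[OF vector_space_axioms])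
    then show ?case using step subspace_add[OF sub] subspace_scale[OF sub]
      by (simp add: plus_grassmann.rep_eq)
  qed
qed

text \<open>The coefficients of a product are signed sums of products of coefficients of the
  factors, and these coefficients lie in \<open>G g\<close>. If all products of that length in
  \<open>G g\<close> vanish, so does the product in the envelope.\<close>

lemma envelope_nonvanishing_product:
  assumes G: "Z2_graded_algebra scale G"
    and ys: "set ys \<subseteq> grassmann_envelope scale G g" "prod_list ys \<noteq> 0"
  shows "\<exists>cs. length cs = length ys \<and> set cs \<subseteq> G g \<and> prod_list cs \<noteq> 0"
proof (rule ccontr)
  interpret Z2_graded_algebra scale G by fact
  assume "\<not> ?thesis"
  then have vanish: "prod_list cs = 0" if "length cs = length ys" "set cs \<subseteq> G g" for cs
    using that by blast
  \<comment> \<open>The list \<open>cs\<close> holds the coefficients already extracted and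
    \<open>zs\<close> the factors still to be expanded; the total length stays fixed.\<close>
  have "prod_list cs * gcoeff (prod_list zs) S = 0"
    if "length cs + length zs = length ys" "set cs \<subseteq> G g" "set zs \<subseteq> grassmann_envelope scale G g"
    for cs zs S
    using that
  proof (induction zs arbitrary: cs S)
    case Nil
    then show ?case using vanish[of cs] by simp
  next
    case (Cons z zs)
    have "prod_list cs * (gcoeff z T * gcoeff (prod_list zs) (S - T)) = 0" for T
      using Cons.IH[of "cs @ [gcoeff z T]" "S - T"] Cons.prems gcoeff_envelope[OF G, of z g T]
      by (simp add: mult.assoc)
    then show ?case
      by (simp add: times_grassmann.rep_eq sum_distrib_left shuffle_sign_commute_left)
  qed
  from this[of "[]" ys] have "gcoeff (prod_list ys) S = 0" for S using ys(1) by simp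
  then have "prod_list ys = 0" by (simp add: gcoeff_inject[symmetric] fun_eq_iff zero_grassmann.rep_eq)
  then show False using ys(2) by simp
qed

text \<open>The variables of the word are distinct, so every product of \<open>n\<close> odd
  elements is one of its values; regularity supplies a nonzero one.\<close>

lemma odd_word_not_identity:
  assumes "Z2_graded_algebra scale G" and "regular_grading scale G \<beta>"
  shows "Poly_Mapping.single (map (Pair 1) [0..<n]) 1 \<notin> T_Z2 scale G"
proof -
  interpret Z2_graded_algebra scale G by fact
  obtain as where as: "list_all2 (\<lambda>a g. a \<in> G g) as (replicate n 1)" "prod_list as \<noteq> 0"
    using assms(2) unfolding regular_grading_def by blast
  then have len: "length as = n" and asG: "\<And>i. i < n \<Longrightarrow> as ! i \<in> G 1"
    by (auto simp: list_all2_conv_all_nth)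
  define \<phi> where "\<phi> p = (if fst p = 1 \<and> snd p < n then as ! snd p else 0)" for p :: "bit \<times> nat"
  have "map \<phi> (map (Pair 1) [0..<n]) = as"
    by (rule nth_equalityI) (auto simp: len \<phi>_def)
  then have "eval_poly scale \<phi> (Poly_Mapping.single (map (Pair 1) [0..<n]) 1) \<noteq> 0"
    using as(2) eval_single[OF assoc_algebra_axioms, of \<phi>] by metis
  moreover have "\<phi> (g, i) \<in> G g" for g i using asG zero_in_component by (auto simp: \<phi>_def)
  ultimately show ?thesis unfolding T_Z2_def by blast
qed

theorem lemma23:
  fixes scaleA :: "'k::{alg_closed_field, field_char_0} \<Rightarrow> 'a::ring_1 \<Rightarrow> 'a"
    and A :: "bit \<Rightarrow> 'a set"
    and \<beta> :: "bit \<Rightarrow> bit \<Rightarrow> 'k"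
    and scaleC :: "'k \<Rightarrow> 'c::ring_1 \<Rightarrow> 'c"
    and C :: "bit \<Rightarrow> 'c set"
  assumes "Z2_graded_algebra scaleA A"
    and "regular_grading scaleA A \<beta>"
    and "minimal_decomposition \<beta>"
    and "Z2_graded_algebra scaleC C"
    and "fin_dim scaleC"
    and "T_Z2 scaleA A = T_Z2 (gscale scaleC) (grassmann_envelope scaleC C)"
  shows "\<exists>(r::nat) (p::nat) (W :: nat \<Rightarrow> 'c set) (c :: nat \<Rightarrow> 'c).
      p \<ge> 1 \<and>
      Z2_graded_algebra.graded_wedderburn_malcev scaleC C (r + p) W \<and>
      (\<forall>i<r. Z2_graded_algebra.trivially_graded_field scaleC C (W i)) \<and>
      (\<forall>i\<in>{r..<r + p}.
         Z2_graded_algebra.field_plus_odd_line scaleC C (W i) (c i) \<and>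
         unit_of (W i) (c i * c i))"
proof -
  interpret A: Z2_graded_algebra scaleA A by fact
  interpret C: Z2_graded_algebra scaleC C by fact
  note \<beta> = minimal_regular_commutation_factors[OF assms(1-3)]
  \<comment> \<open>Commutation with factor \<open>\<beta> g h\<close> is an identity of
    \<open>A\<close>, hence of the envelope; there the sign of the odd letters absorbs the
    factor.\<close>
  have homog: "x * y = y * x" if x: "x \<in> C g" and y: "y \<in> C h" for x y g h
  proof (rule envelope_supercommutative_imp_commute[OF C.assoc_algebra_axioms _ _ x y])
    have "g = 0 \<or> g = 1" "h = 0 \<or> h = 1" using UNIV_bit by auto
    then show "\<beta> g h = (if g = 1 \<and> h = 1 then - 1 else 1)" using \<beta> by auto
    have "commutation_poly g h (\<beta> g h) \<in> T_Z2 scaleA A"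
      using assms(2) unfolding T_Z2_def regular_grading_def
      by (simp add: eval_commutation_poly[OF A.assoc_algebra_axioms])
    then show "commutation_poly g h (\<beta> g h) \<in> T_Z2 (gscale scaleC) (grassmann_envelope scaleC C)"
      using assms(6) by simp
  qed
  interpret C: comm_graded_algebra scaleC C
  proof unfold_locales
    fix x y :: 'c
    obtain a b a' b' where "a \<in> C 0" "b \<in> C 1" "x = a + b" "a' \<in> C 0" "b' \<in> C 1" "y = a' + b'"
      using C.homogeneous_decomposition by metis
    then show "x * y = y * x" using homog by (simp add: distrib_left distrib_right add_ac)
  qed (fact assms(5))
  \<comment> \<open>The odd word of length \<open>n\<close> is not an identity of \<open>A\<close>,
    hence not one of the envelope, and a nonzero value there descends to \<open>C\<close>.\<close>
  have "\<exists>cs. length cs = n \<and> set cs \<subseteq> C 1 \<and> prod_list cs \<noteq> 0" for n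
  proof -
    let ?w = "map (Pair 1) [0..<n] :: (bit \<times> nat) list"
    have "Poly_Mapping.single ?w 1 \<notin> T_Z2 (gscale scaleC) (grassmann_envelope scaleC C)"
      using odd_word_not_identity[OF assms(1,2)] assms(6) by simp
    then obtain \<phi> where \<phi>: "\<forall>g i. \<phi> (g, i) \<in> grassmann_envelope scaleC C g"
      "eval_poly (gscale scaleC) \<phi> (Poly_Mapping.single ?w 1) \<noteq> 0"
      unfolding T_Z2_def by blast
    have "prod_list (map \<phi> ?w) \<noteq> 0"
      using \<phi>(2) eval_single[OF assoc_algebra_gscale[OF C.assoc_algebra_axioms]] by metis
    moreover have "set (map \<phi> ?w) \<subseteq> grassmann_envelope scaleC C 1" using \<phi>(1) by auto
    ultimately show ?thesis
      using envelope_nonvanishing_product[OF assms(4), of "map \<phi> ?w" 1] by simp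
  qed
  then have "\<exists>x\<in>C 1. \<not> nilpotent x" by (rule C.nonnilpotent_of_nonzero_products)
  then show ?thesis by (rule C.graded_wedderburn_malcev_exists)
qed

end
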